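(* Let $n\geq 2$ and let $M$ be a matching of the hypercube $Q_n$ with $|M|\leq 2n-1$. Then there exists a Hamiltonian cycle of $Q_n$ containing every edge of $M$.
   Context: The $n$-dimensional hypercube $Q_n$ has as vertices all binary strings of length $n$, two vertices being adjacent iff they differ in exactly one position. A matching is a set of pairwise vertex-disjoint edges. *)

theory Defs
  imports Main
begin

text \<open>A simple graph is given by a vertex set and a set of edges, an edge being the
  two-element set of its endpoints.\<close>

definition hypercube_verts :: "nat \<Rightarrow> bool list set" where
  "hypercube_verts n = {v. length v = n}"

definition hypercube_edges :: "nat \<Rightarrow> bool list set set" where
  "hypercube_edges n =
     {{u, v} | u v. u \<in> hypercube_verts n \<and> v \<in> hypercube_verts n \<and>
                    (\<exists>!i. i < n \<and> u ! i \<noteq> v ! i)}"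

definition matching :: "'a set set \<Rightarrow> 'a set set \<Rightarrow> bool" where
  "matching E M \<longleftrightarrow> M \<subseteq> E \<and> pairwise disjnt M"

text \<open>A cycle is listed by its vertices in cyclic order, without repeating the first one
  at the end; the edge from the last vertex back to the first is included.\<close>

definition cycle_edges :: "'a list \<Rightarrow> 'a set set" where
  "cycle_edges c = {{c ! i, c ! (Suc i mod length c)} | i. i < length c}"

text \<open>The length bound excludes an edge traversed back and forth, which is not a cycle
  of a simple graph.\<close>

definition hamiltonian_cycle :: "'a set \<Rightarrow> 'a set set \<Rightarrow> 'a list \<Rightarrow> bool" where
  "hamiltonian_cycle V E c \<longleftrightarrow>
     3 \<le> length c \<and> distinct c \<and> set c = V \<and> cycle_edges c \<subseteq> E"

end

theory Submission
  imports Defs "HOL-Library.Multiset"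
begin

text \<open>
  The proof is by induction on the dimension $n$, splitting the cube along a direction $d$ that
  carries at most one edge of the matching; such a direction exists because $|M| < 2n$. Two
  statements are proved together: every matching of at most $2n - 1$ edges lies on a Hamiltonian
  cycle, and for a matching of at most $n$ edges missing a vertex $a$, every edge $ab$ is closed to
  a Hamiltonian cycle by a Hamiltonian path from $a$ to $b$ through the matching. If $M_0$ and
  $M_1$ are the parts of $M$ in the two halves with $|M_1| \<le> |M_0| \<le> 2n - 3$, then the first
  statement gives a cycle through $M_0$. It is cut at an edge $xy \<notin> M$ whose end $x$ lies below
  an unmatched vertex $x'$ (the crossing edge of $M$, if there is one, is taken to be $xx'$), and a
  path from $x'$ to $y'$ through $M_1$ is spliced in by the second statement. If $|M_0| > 2n - 3$,
  then nearly all of $M$ lies in one half. If all of $M$ does, up to a crossing edge, then $M$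
  extends to a perfect matching, and Fink's theorem applies; otherwise one edge of $M_0$ is dropped
  before the induction hypothesis is used and is put back as a chord.
\<close>

section \<open>Paths and cycles as vertex lists\<close>

text \<open>The two bounds fit together by halving: if |M1| <= |M0| and |M| <= 2n - 1, then |M1| <=
  n - 1, which is exactly what the path statement allows in dimension n - 1. Conversely, the path
  statement follows from the cycle statement in the same dimension whenever b is unmatched: the edge
  ab can be added to M, and n + 1 <= 2n - 1. The real work for paths is thus the case of a matched
  b. There the cube is split along a direction other than that of ab, so that a and b stay in one
  half; this leaves one direction fewer to choose from, but n < 2(n - 1) still yields a sparse one
  once n >= 3. The square is treated by hand. The obstacle to splicing is that the cube is bipartite
  and that a path cannot contain the edge joining its own ends. A half with at most one prescribed
  edge can be traversed between any two ends of opposite parity (Hamiltonian laceability). A half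
  with more prescribed edges is traversed only between adjacent ends, by the path statement if one
  of them is unmatched there, or by opening a cycle.\<close>

fun path_edges :: "'a list \<Rightarrow> 'a set set" where
  "path_edges (x # y # zs) = insert {x, y} (path_edges (y # zs))"
| "path_edges _ = {}"

lemma path_edges_Cons:
  "path_edges (x # ys) = path_edges ys \<union> (if ys = [] then {} else {{x, hd ys}})"
  by (cases ys) auto

lemma path_edges_append:
  "path_edges (xs @ ys) =
     path_edges xs \<union> path_edges ys \<union> (if xs = [] \<or> ys = [] then {} else {{last xs, hd ys}})"
  by (induction xs) (auto simp: path_edges_Cons hd_append)

lemma path_edges_rev [simp]: "path_edges (rev xs) = path_edges xs"
  by (induction xs)
    (auto simp: path_edges_append path_edges_Cons last_rev insert_commute)

lemma path_edges_subset: "e \<in> path_edges xs \<Longrightarrow> e \<subseteq> set xs"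
  by (induction xs rule: path_edges.induct) auto

lemma path_edges_split:
  assumes "e \<in> path_edges xs"
  obtains ps qs where "xs = ps @ qs" "ps \<noteq> []" "qs \<noteq> []" "e = {last ps, hd qs}"
  using assms
proof (induction xs arbitrary: thesis rule: path_edges.induct)
  case (1 x y zs)
  show ?case
  proof (cases "e = {x, y}")
    case True
    then show ?thesis using "1.prems"(1)[of "[x]" "y # zs"] by simp
  next
    case False
    then obtain ps qs where "y # zs = ps @ qs" "ps \<noteq> []" "qs \<noteq> []" "e = {last ps, hd qs}"
      using "1.IH" "1.prems"(2) by auto
    then show ?thesis using "1.prems"(1)[of "x # ps" qs] by simp
  qed
qed auto

lemma path_edges_nth: "path_edges xs = {{xs ! i, xs ! Suc i} | i. Suc i < length xs}"
proof (induction xs rule: path_edges.induct)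
  case (1 x y zs)
  have "{{(x # y # zs) ! i, (x # y # zs) ! Suc i} | i. Suc i < length (x # y # zs)} =
      insert {x, y} {{(y # zs) ! i, (y # zs) ! Suc i} | i. Suc i < length (y # zs)}"
    (is "?L = ?R")
  proof
    show "?L \<subseteq> ?R"
    proof
      fix e assume "e \<in> ?L"
      then obtain i where "e = {(x # y # zs) ! i, (x # y # zs) ! Suc i}" "Suc i < length (x # y # zs)"
        by blast
      then show "e \<in> ?R" by (cases i) auto
    qed
    have "{x, y} \<in> ?L" by force
    moreover have "{(y # zs) ! i, (y # zs) ! Suc i} \<in> ?L" if "Suc i < length (y # zs)" for i
      using that by (intro CollectI exI[of _ "Suc i"]) auto
    ultimately show "?R \<subseteq> ?L" by blast
  qed
  then show ?case using 1 by simp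
qed auto

definition closed_edges :: "'a list \<Rightarrow> 'a set set" where
  "closed_edges xs = insert {last xs, hd xs} (path_edges xs)"

lemma closed_edges_rotate: "xs \<noteq> [] \<Longrightarrow> ys \<noteq> [] \<Longrightarrow> closed_edges (xs @ ys) = closed_edges (ys @ xs)"
  by (auto simp: closed_edges_def path_edges_append)

text \<open>Cutting and splicing is done with the recursive \<open>path_edges\<close>; this is the
  bridge to the modular indices of \<open>cycle_edges\<close>, crossed once at the very end.\<close>

lemma closed_edges_eq_cycle_edges:
  assumes "xs \<noteq> []"
  shows "closed_edges xs = cycle_edges xs"
proof -
  have "cycle_edges xs = (\<lambda>i. {xs ! i, xs ! (Suc i mod length xs)}) ` {..<length xs}"
    by (auto simp: cycle_edges_def)
  also have "{..<length xs} = insert (length xs - 1) {i. Suc i < length xs}"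
    using assms by (cases xs) auto
  also have "(\<lambda>i. {xs ! i, xs ! (Suc i mod length xs)}) ` \<dots> =
      insert {xs ! (length xs - 1), xs ! 0} {{xs ! i, xs ! Suc i} | i. Suc i < length xs}"
    using assms by auto
  also have "\<dots> = closed_edges xs"
    using assms by (simp add: closed_edges_def path_edges_nth last_conv_nth hd_conv_nth)
  finally show ?thesis by simp
qed

text \<open>Vertices are encoded by the set of positions carrying a 1. The subcube \<open>cube D b\<close> passes through \<open>b\<close>
  and has the free directions \<open>D\<close>, so both halves of a cube are again of this form.\<close>

definition flip :: "nat \<Rightarrow> nat set \<Rightarrow> nat set" where
  "flip i X = (if i \<in> X then X - {i} else insert i X)"

definition cube_edges :: "nat set set set" where
  "cube_edges = {{X, flip i X} | X i. True}"

definition cube :: "nat set \<Rightarrow> nat set \<Rightarrow> nat set set" where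
  "cube D b = {X. X - D = b - D}"

definition ham_path :: "nat set set \<Rightarrow> nat set set set \<Rightarrow> nat set \<Rightarrow> nat set \<Rightarrow> bool" where
  "ham_path V F s t \<longleftrightarrow> (\<exists>xs. xs \<noteq> [] \<and> hd xs = s \<and> last xs = t \<and> distinct xs \<and> set xs = V \<and>
     path_edges xs \<subseteq> cube_edges \<and> F \<subseteq> path_edges xs)"

text \<open>There is no length bound: a single edge, traversed back and forth, counts as a cycle here.\<close>

definition ham_cycle :: "nat set set \<Rightarrow> nat set set set \<Rightarrow> bool" where
  "ham_cycle V F \<longleftrightarrow> (\<exists>xs. xs \<noteq> [] \<and> distinct xs \<and> set xs = V \<and>
     closed_edges xs \<subseteq> cube_edges \<and> F \<subseteq> closed_edges xs)"

lemma ham_pathI: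
  assumes "xs \<noteq> []" "hd xs = s" "last xs = t" "distinct xs" "set xs = V"
    "path_edges xs \<subseteq> cube_edges" "F \<subseteq> path_edges xs"
  shows "ham_path V F s t"
  using assms unfolding ham_path_def by blast

lemma ham_path_mono: "ham_path V F s t \<Longrightarrow> G \<subseteq> F \<Longrightarrow> ham_path V G s t"
  unfolding ham_path_def by blast

lemma ham_cycle_mono: "ham_cycle V F \<Longrightarrow> G \<subseteq> F \<Longrightarrow> ham_cycle V G"
  unfolding ham_cycle_def by blast

lemma ham_path_rev:
  assumes "ham_path V F s t"
  shows "ham_path V F t s"
proof -
  from assms obtain xs where "xs \<noteq> []" "hd xs = s" "last xs = t" "distinct xs" "set xs = V"
    "path_edges xs \<subseteq> cube_edges" "F \<subseteq> path_edges xs"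
    unfolding ham_path_def by blast
  then show ?thesis
    by (intro ham_pathI[of "rev xs"]) (auto simp: hd_rev last_rev)
qed

lemma ham_path_ends: "ham_path V F s t \<Longrightarrow> s \<in> V \<and> t \<in> V"
  unfolding ham_path_def by auto

section \<open>Joining and splicing Hamiltonian paths of disjoint vertex sets\<close>

lemma ham_path_join:
  assumes "ham_path A F s t" "ham_path B G u v" "A \<inter> B = {}" "{t, u} \<in> cube_edges"
  shows "ham_path (A \<union> B) (insert {t, u} (F \<union> G)) s v"
proof -
  from assms(1) obtain xs where xs: "xs \<noteq> []" "hd xs = s" "last xs = t" "distinct xs" "set xs = A"
    "path_edges xs \<subseteq> cube_edges" "F \<subseteq> path_edges xs"
    unfolding ham_path_def by blast
  from assms(2) obtain ys where ys: "ys \<noteq> []" "hd ys = u" "last ys = v" "distinct ys" "set ys = B"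
    "path_edges ys \<subseteq> cube_edges" "G \<subseteq> path_edges ys"
    unfolding ham_path_def by blast
  show ?thesis
    using xs ys assms(3,4)
    by (intro ham_pathI[of "xs @ ys"]) (auto simp: path_edges_append)
qed

lemma ham_path_close:
  assumes "ham_path V F s t" "{t, s} \<in> cube_edges"
  shows "ham_cycle V (insert {t, s} F)"
  using assms unfolding ham_path_def ham_cycle_def closed_edges_def by blast

lemma ham_cycle_join:
  assumes "ham_path A F s t" "ham_path B G u v" "A \<inter> B = {}"
    "{s, u} \<in> cube_edges" "{t, v} \<in> cube_edges"
  shows "ham_cycle (A \<union> B) (insert {s, u} (insert {t, v} (F \<union> G)))"
proof -
  have "ham_path (A \<union> B) (insert {t, v} (F \<union> G)) s u"
    using ham_path_join[OF assms(1) ham_path_rev[OF assms(2)]] assms by blast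
  from ham_path_close[OF this] assms(4) show ?thesis
    by (simp add: insert_commute)
qed

text \<open>The detour through \<open>B\<close> goes between \<open>ps\<close> and
  \<open>qs\<close>. Adjacency of \<open>last ps\<close> and \<open>hd qs\<close> is deliberately
  not assumed: \<open>path_ext_facet\<close> splices a rearranged sequence in which they need not be
  adjacent.\<close>

lemma ham_path_insert:
  assumes "ps \<noteq> []" "qs \<noteq> []" "distinct (ps @ qs)" "set (ps @ qs) = A"
    "path_edges ps \<union> path_edges qs \<subseteq> cube_edges" "A \<inter> B = {}"
    "ham_path B G u v" "{last ps, u} \<in> cube_edges" "{v, hd qs} \<in> cube_edges"
    "F \<subseteq> path_edges ps \<union> path_edges qs"
  shows "ham_path (A \<union> B) (insert {last ps, u} (insert {v, hd qs} (F \<union> G))) (hd ps) (last qs)"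
proof -
  have "ham_path (set ps) (path_edges ps) (hd ps) (last ps)"
    using assms by (intro ham_pathI[of ps]) (auto simp: path_edges_append)
  from ham_path_join[OF this assms(7)] assms
  have 1: "ham_path (set ps \<union> B) (insert {last ps, u} (path_edges ps \<union> G)) (hd ps) v"
    by fastforce
  have "ham_path (set qs) (path_edges qs) (hd qs) (last qs)"
    using assms by (intro ham_pathI[of qs]) (auto simp: path_edges_append)
  from ham_path_join[OF 1 this] assms
  have "ham_path (set ps \<union> B \<union> set qs)
      (insert {v, hd qs} (insert {last ps, u} (path_edges ps \<union> G) \<union> path_edges qs)) (hd ps) (last qs)"
    by fastforce
  moreover have "set ps \<union> B \<union> set qs = A \<union> B" using assms by auto
  ultimately show ?thesis using assms by (auto elim!: ham_path_mono)
qed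

section \<open>Opening Hamiltonian cycles into Hamiltonian paths\<close>

lemma ham_cycle_rotate:
  assumes "ham_cycle V F" "w \<in> V"
  obtains zs where "distinct (w # zs)" "set (w # zs) = V" "closed_edges (w # zs) \<subseteq> cube_edges"
    "F \<subseteq> closed_edges (w # zs)"
proof -
  from assms(1) obtain xs where xs: "xs \<noteq> []" "distinct xs" "set xs = V"
    "closed_edges xs \<subseteq> cube_edges" "F \<subseteq> closed_edges xs"
    unfolding ham_cycle_def by blast
  with assms(2) obtain us vs where "xs = us @ w # vs" by (meson split_list)
  moreover from this have "closed_edges (w # vs @ us) = closed_edges xs"
    using closed_edges_rotate[of "us" "w # vs"] by (cases "us = []") auto
  ultimately show thesis using xs by (intro that[of "vs @ us"]) auto
qed

text \<open>Two distinct cycle edges meet at \<open>w\<close>, and a matching contains at most one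
  of them; the cycle is cut at the other. The bound on \<open>card V\<close> makes the two edges
  distinct.\<close>

lemma ham_cycle_open:
  assumes "ham_cycle V M" "\<And>e f. e \<in> M \<Longrightarrow> f \<in> M \<Longrightarrow> e \<inter> f \<noteq> {} \<Longrightarrow> e = f" "w \<in> V" "card V > 2"
  obtains y where "{w, y} \<in> cube_edges" "{w, y} \<notin> M" "ham_path V M w y"
proof -
  obtain zs where zs: "distinct (w # zs)" "set (w # zs) = V" "closed_edges (w # zs) \<subseteq> cube_edges"
    "M \<subseteq> closed_edges (w # zs)"
    using ham_cycle_rotate[OF assms(1,3)] .
  have "length zs > 1" using zs(1,2) assms(4) distinct_card[of "w # zs"] by simp
  then obtain a us where us: "zs = a # us" "us \<noteq> []" by (cases zs) auto
  then have "last us \<noteq> a" using zs(1) last_in_set[of us] by auto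
  then have zs': "zs \<noteq> []" "hd zs \<noteq> last zs" using us by auto
  show thesis
  proof (cases "{last zs, w} \<in> M")
    case False
    have "ham_path V M w (last zs)"
      using zs zs' False by (intro ham_pathI[of "w # zs"]) (auto simp: closed_edges_def)
    then show thesis using that[of "last zs"] zs zs' False
      by (auto simp: closed_edges_def insert_commute)
  next
    case True
    \<comment> \<open>The closing edge at \<open>w\<close> belongs to \<open>M\<close>, so the first
      edge is cut instead, which amounts to moving \<open>w\<close> from the front to the end of the
      list.\<close>
    have ne: "{w, hd zs} \<noteq> {last zs, w}" using zs' by (auto simp: doubleton_eq_iff)
    then have nM: "{w, hd zs} \<notin> M" using assms(2)[OF True] by fastforce
    have eq: "insert {w, hd zs} (path_edges (zs @ [w])) = closed_edges (w # zs)"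
      using closed_edges_rotate[of zs "[w]"] zs' by (simp add: closed_edges_def)
    then have "path_edges (zs @ [w]) \<subseteq> cube_edges" "M \<subseteq> path_edges (zs @ [w])"
      using zs(3,4) nM unfolding eq[symmetric] by blast+
    then have "ham_path V M (hd zs) w"
      using zs(1,2) zs' by (intro ham_pathI[of "zs @ [w]"]) auto
    from ham_path_rev[OF this] show thesis using that[of "hd zs"] zs zs' nM
      by (auto simp: closed_edges_def path_edges_Cons)
  qed
qed

lemma ham_cycle_open_edge:
  assumes "ham_cycle V (insert {x, y} M)" "{x, y} \<notin> M" "x \<in> V" "x \<noteq> y"
  shows "ham_path V M x y"
proof -
  obtain zs where zs: "distinct (x # zs)" "set (x # zs) = V" "closed_edges (x # zs) \<subseteq> cube_edges"
    "insert {x, y} M \<subseteq> closed_edges (x # zs)"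
    using ham_cycle_rotate[OF assms(1,3)] .
  have "zs \<noteq> []" using zs(4) assms(4) by (auto simp: closed_edges_def doubleton_eq_iff)
  have "{x, y} \<notin> path_edges zs" using path_edges_subset zs(1) by fastforce
  then consider "y = last zs" | "y = hd zs"
    using zs(4) \<open>zs \<noteq> []\<close> by (auto simp: closed_edges_def path_edges_Cons doubleton_eq_iff)
  then show ?thesis
  proof cases
    case 1
    then show ?thesis using zs \<open>zs \<noteq> []\<close> assms(2)
      by (intro ham_pathI[of "x # zs"]) (auto simp: closed_edges_def insert_commute)
  next
    case 2
    have eq: "insert {x, hd zs} (path_edges (zs @ [x])) = closed_edges (x # zs)"
      using closed_edges_rotate[of zs "[x]"] \<open>zs \<noteq> []\<close> by (simp add: closed_edges_def)
    then have "path_edges (zs @ [x]) \<subseteq> cube_edges" "M \<subseteq> path_edges (zs @ [x])"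
      using zs(3,4) assms(2) 2 unfolding eq[symmetric] by blast+
    then have "ham_path V M y x" using zs(1,2) \<open>zs \<noteq> []\<close> 2
      by (intro ham_pathI[of "zs @ [x]"]) auto
    then show ?thesis by (rule ham_path_rev)
  qed
qed

text \<open>If the cycle reads x, c1, y, c2, then the path c1, y, x, reversed c2 contains the edge
  xy. The only edges given up lead from x into c1 and from y into c2; they meet x or y, so none of
  them lies in \<open>N\<close>.\<close>

lemma ham_cycle_chord:
  assumes "ham_cycle V N" "x \<in> V" "y \<in> V" "x \<noteq> y" "{x, y} \<in> cube_edges" "x \<notin> \<Union>N" "y \<notin> \<Union>N"
  obtains s t where "ham_path V (insert {x, y} N) s t"
proof -
  obtain zs where zs: "distinct (x # zs)" "set (x # zs) = V" "closed_edges (x # zs) \<subseteq> cube_edges"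
    "N \<subseteq> closed_edges (x # zs)"
    using ham_cycle_rotate[OF assms(1,2)] .
  from zs(2) assms(3,4) have "y \<in> set zs" by auto
  then obtain c1 c2 where c: "zs = c1 @ y # c2" by (meson split_list)
  let ?p = "c1 @ [y, x] @ rev c2"
  have "N \<subseteq> path_edges ?p"
  proof
    fix e assume "e \<in> N"
    then have "e \<in> closed_edges (x # c1 @ y # c2)" "x \<notin> e" "y \<notin> e" using zs c assms(6,7) by auto
    then show "e \<in> path_edges ?p"
      by (auto simp: closed_edges_def path_edges_Cons path_edges_append split: if_splits)
  qed
  moreover have "{x, y} \<in> path_edges ?p"
    by (auto simp: path_edges_Cons path_edges_append insert_commute)
  moreover have "path_edges ?p \<subseteq> cube_edges"
    using zs c assms(5)
    by (auto simp: closed_edges_def path_edges_Cons path_edges_append insert_commute hd_rev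
        split: if_splits)
  ultimately have "ham_path V (insert {x, y} N) (hd ?p) (last ?p)"
    using zs c by (intro ham_pathI[of ?p]) auto
  then show thesis using that by blast
qed

section \<open>Subcubes and laceability\<close>

lemma flip_flip [simp]: "flip i (flip i X) = X"
  by (auto simp: flip_def)

lemma flip_neq [simp]: "flip i X \<noteq> X" "X \<noteq> flip i X"
  by (auto simp: flip_def)

lemma mem_flip: "j \<in> flip i X \<longleftrightarrow> (j \<in> X) \<noteq> (i = j)"
  by (auto simp: flip_def)

lemma flip_commute: "flip i (flip j X) = flip j (flip i X)"
  by (auto simp: mem_flip)

lemma flip_eq_iff [simp]: "flip i X = flip i Y \<longleftrightarrow> X = Y"
  by (metis flip_flip)

lemma flip_dir_eq [simp]: "flip i X = flip j X \<longleftrightarrow> i = j"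
  by (auto simp: flip_def split: if_splits)

lemma finite_flip [simp]: "finite (flip i X) = finite X"
  by (simp add: flip_def)

text \<open>The parity of the cardinality is the bipartition of the cube. It is meaningful only for
  finite sets, whence the finiteness assumptions on base vertices later on.\<close>

lemma even_card_flip: "finite X \<Longrightarrow> even (card (flip i X)) \<longleftrightarrow> odd (card X)"
  by (cases "i \<in> X") (auto simp: flip_def card.insert_remove card_Diff_singleton card_gt_0_iff)

lemma flip_edge [simp]: "{X, flip i X} \<in> cube_edges" "{flip i X, X} \<in> cube_edges"
  by (auto simp: cube_edges_def insert_commute)

lemma cube_edge_iff: "{x, y} \<in> cube_edges \<longleftrightarrow> (\<exists>i. y = flip i x)"
proof
  assume "{x, y} \<in> cube_edges"
  then obtain X i where "{x, y} = {X, flip i X}" by (auto simp: cube_edges_def)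
  then show "\<exists>i. y = flip i x" by (metis doubleton_eq_iff flip_flip)
qed (auto simp: cube_edges_def)

lemma cube_edge_dir_eq: "{x, flip i x} = {y, flip j y} \<Longrightarrow> i = j"
  by (auto simp: doubleton_eq_iff flip_commute) (metis flip_flip flip_dir_eq)

lemma mem_cube: "x \<in> cube D a \<longleftrightarrow> x - D = a - D"
  by (auto simp: cube_def)

lemma cube_self [simp]: "a \<in> cube D a"
  by (simp add: mem_cube)

lemma cube_eq: "x \<in> cube D a \<Longrightarrow> cube D x = cube D a"
  by (simp add: cube_def)

lemma cube_empty [simp]: "cube {} a = {a}"
  by (auto simp: cube_def)

lemma flip_in_cube [simp]: "i \<in> D \<Longrightarrow> flip i x \<in> cube D a \<longleftrightarrow> x \<in> cube D a"
  by (auto simp: mem_cube flip_def)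

lemma flip_in_cube_flip [simp]: "flip i x \<in> cube D (flip i a) \<longleftrightarrow> x \<in> cube D a"
  by (auto simp: mem_cube flip_def)

lemma flip_in_cubeD: "flip i x \<in> cube D a \<Longrightarrow> x \<in> cube D a \<Longrightarrow> i \<in> D"
  by (auto simp: mem_cube flip_def split: if_splits)

lemma cube_Diff_mem: "d \<in> D \<Longrightarrow> x \<in> cube (D - {d}) a \<longleftrightarrow> x \<in> cube D a \<and> (d \<in> x \<longleftrightarrow> d \<in> a)"
  by (auto simp: mem_cube)

lemma cube_flip: "d \<in> D \<Longrightarrow> cube D (flip d a) = cube D a"
  using cube_eq[of "flip d a" D a] by (auto simp: mem_cube flip_def)

lemma cube_split: "d \<in> D \<Longrightarrow> cube D a = cube (D - {d}) a \<union> cube (D - {d}) (flip d a)"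
  by (auto simp: cube_Diff_mem cube_flip mem_flip)

lemma cube_disjoint: "d \<in> D \<Longrightarrow> cube (D - {d}) a \<inter> cube (D - {d}) (flip d a) = {}"
  by (auto simp: cube_Diff_mem mem_flip)

lemma cube_bij: "bij_betw (\<lambda>X. (a - D) \<union> X) (Pow D) (cube D a)"
  by (rule bij_betw_byWitness[where f' = "\<lambda>X. X \<inter> D"]) (auto simp: mem_cube)

lemma finite_cube: "finite D \<Longrightarrow> finite (cube D a)"
  using bij_betw_finite[OF cube_bij] by blast

lemma card_cube: "finite D \<Longrightarrow> card (cube D a) = 2 ^ card D"
  using bij_betw_same_card[OF cube_bij, of D a] by (simp add: card_Pow)

lemma finite_mem_cube: "x \<in> cube D a \<Longrightarrow> finite D \<Longrightarrow> finite a \<Longrightarrow> finite x"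
  by (metis finite_Diff2 mem_cube)

lemma cube_edge_split:
  assumes "e \<in> cube_edges" "e \<subseteq> cube D a" "d \<in> D"
  shows "e \<subseteq> cube (D - {d}) a \<or> e \<subseteq> cube (D - {d}) (flip d a) \<or>
    (\<exists>x\<in>cube (D - {d}) a. e = {x, flip d x})"
proof -
  obtain x i where e: "e = {x, flip i x}" using assms(1) by (auto simp: cube_edges_def)
  have x: "x \<in> cube D a" using e assms(2) by auto
  show ?thesis
  proof (cases "i = d")
    case True
    consider "x \<in> cube (D - {d}) a" | "flip d x \<in> cube (D - {d}) a"
      using x cube_split[OF assms(3), of a] flip_in_cube_flip[of d x "D - {d}" "flip d a"]
      by (auto simp del: flip_in_cube_flip)
    then show ?thesis
    proof cases
      case 2
      have "e = {flip d x, flip d (flip d x)}" using e True by auto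
      with 2 show ?thesis by blast
    qed (use e True in blast)
  next
    case False
    then have "d \<in> flip i x \<longleftrightarrow> d \<in> x" by (simp add: mem_flip)
    moreover have "flip i x \<in> cube D a" using e assms(2) by blast
    ultimately show ?thesis using e x assms(3)
      by (cases "d \<in> x \<longleftrightarrow> d \<in> a") (simp_all add: cube_Diff_mem cube_flip mem_flip)
  qed
qed

lemma path_parity:
  assumes "xs \<noteq> []" "path_edges xs \<subseteq> cube_edges" "\<And>x. x \<in> set xs \<Longrightarrow> finite x"
  shows "(even (card (hd xs)) \<longleftrightarrow> even (card (last xs))) \<longleftrightarrow> odd (length xs)"
  using assms
proof (induction xs rule: path_edges.induct)
  case (1 x y zs)
  then obtain i where "y = flip i x" by (auto simp: cube_edge_iff)
  then have "even (card y) \<longleftrightarrow> odd (card x)" using "1.prems"(3)[of x] by (simp add: even_card_flip)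
  moreover have "(even (card y) \<longleftrightarrow> even (card (last (y # zs)))) \<longleftrightarrow> odd (length (y # zs))"
    using "1.IH" "1.prems" by simp
  moreover have "hd (x # y # zs) = x" "last (x # y # zs) = last (y # zs)"
    "length (x # y # zs) = Suc (length (y # zs))" "hd (y # zs) = y" by simp_all
  ultimately show ?case by (metis even_Suc)
qed auto

lemma ham_path_parity:
  assumes "ham_path V F s t" "\<And>x. x \<in> V \<Longrightarrow> finite x" "even (card V)"
  shows "even (card s) \<noteq> even (card t)"
  using assms path_parity unfolding ham_path_def by (metis distinct_card)

lemma ham_path_splice:
  assumes "ps \<noteq> []" "qs \<noteq> []" "distinct (ps @ qs)" "set (ps @ qs) = A"
    "path_edges ps \<union> path_edges qs \<subseteq> cube_edges" "A \<inter> B = {}"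
    "ham_path B G (flip d (last ps)) (flip d (hd qs))"
    "F \<subseteq> path_edges ps \<union> path_edges qs"
  shows "ham_path (A \<union> B)
    ({{last ps, flip d (last ps)}, {hd qs, flip d (hd qs)}} \<union> F \<union> G) (hd ps) (last qs)"
proof -
  have "ham_path (A \<union> B) (insert {last ps, flip d (last ps)}
      (insert {flip d (hd qs), hd qs} (F \<union> G))) (hd ps) (last qs)"
    using assms by (intro ham_path_insert) auto
  then show ?thesis by (rule ham_path_mono) (auto simp: insert_commute)
qed

lemma ham_path_edge: "ham_path {s, flip i s} {{s, flip i s}} s (flip i s)"
  by (rule ham_pathI[of "[s, flip i s]"]) auto

lemma cube_singleton: "cube {i} s = {s, flip i s}"
  using cube_split[of i "{i}" s] by auto

text \<open>Hamiltonian laceability with at most one prescribed edge \<open>f\<close>. If some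
  direction separates \<open>s\<close> from \<open>t\<close> and is not that of \<open>f\<close>,
  the cube is split there and two paths are joined by one crossing edge. Otherwise \<open>st\<close>
  is an edge parallel to \<open>f\<close>; then a direction separating the two edges is used, and a
  path from \<open>s\<close> to \<open>t\<close> in one half takes a detour through \<open>f\<close>
  in the other. The last premise excludes the edge \<open>st\<close> itself, which such a path
  contains only in dimension 1.\<close>

theorem cube_laceable:
  assumes "finite D" "D \<noteq> {}" "finite s" "t \<in> cube D s" "even (card s) \<noteq> even (card t)"
    and "F \<subseteq> {f}" "F \<subseteq> cube_edges" "\<And>e. e \<in> F \<Longrightarrow> e \<subseteq> cube D s"
    and "{s, t} \<notin> F \<or> card D = 1"
  shows "ham_path (cube D s) F s t"
  using assms
proof (induction "card D" arbitrary: D s t F rule: less_induct)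
  case less
  show ?case
  proof (cases "card D = 1")
    case True
    then obtain i where i: "D = {i}" by (auto simp: card_1_singleton_iff)
    then have t: "t = flip i s" using less.prems by (auto simp: cube_singleton)
    have "e = {s, flip i s}" if "e \<in> F" for e
    proof -
      have "e \<in> cube_edges" using that less.prems(7) by (rule rev_subsetD)
      then obtain x j where e: "e = {x, flip j x}" by (auto simp: cube_edges_def)
      have "e \<subseteq> {s, flip i s}" using less.prems(8)[OF that] i by (simp add: cube_singleton)
      then have "x \<in> {s, flip i s}" "flip j x \<in> {s, flip i s}" using e by auto
      moreover have "flip j x \<noteq> x" by simp
      ultimately have "(x = s \<and> flip j x = flip i s) \<or> (x = flip i s \<and> flip j x = s)" by blast
      then show ?thesis unfolding e by blast
    qed
    then show ?thesis using ham_path_edge[of s i] t i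
      by (auto simp: cube_singleton elim!: ham_path_mono)
  next
    case False
    with less.prems have card: "card D \<ge> 2"
      by (metis One_nat_def Suc_leI card_gt_0_iff le_neq_implies_less numeral_2_eq_2)
    have IH: "ham_path (cube (D - {d}) s') F' s' t'"
      if "d \<in> D" "finite s'" "t' \<in> cube (D - {d}) s'" "even (card s') \<noteq> even (card t')"
        "F' \<subseteq> F" "\<And>e. e \<in> F' \<Longrightarrow> e \<subseteq> cube (D - {d}) s'" "{s', t'} \<notin> F' \<or> card (D - {d}) = 1"
      for d s' t' F'
    proof (rule less.hyps)
      show "card (D - {d}) < card D" by (rule psubset_card_mono) (use that less.prems in auto)
      show "D - {d} \<noteq> {}" using card that(1) by (metis card_Diff_singleton card.empty One_nat_def
            Suc_1 diff_is_0_eq not_less_eq_eq)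
    qed (use that less.prems in auto)
    show ?thesis
    proof (cases "\<exists>d\<in>D. t \<notin> cube (D - {d}) s \<and>
        (\<forall>e\<in>F. e \<subseteq> cube (D - {d}) s \<or> e \<subseteq> cube (D - {d}) (flip d s))")
      case True
      then obtain d where d: "d \<in> D" "t \<notin> cube (D - {d}) s"
        and F: "\<And>e. e \<in> F \<Longrightarrow> e \<subseteq> cube (D - {d}) s \<or> e \<subseteq> cube (D - {d}) (flip d s)"
        by blast
      let ?A = "cube (D - {d}) s" and ?B = "cube (D - {d}) (flip d s)"
      have tB: "t \<in> ?B" using d less.prems(4) cube_split[OF d(1)] by auto
      have cD: "card (D - {d}) \<ge> 1" using card d less.prems by simp
      obtain i where i: "i \<in> D - {d}" "{s, flip i s} \<notin> F \<or> card (D - {d}) = 1"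
        "{flip d (flip i s), t} \<notin> F \<or> card (D - {d}) = 1"
      proof (cases "card (D - {d}) = 1")
        case True
        then show ?thesis using that by (metis card_1_singletonE insertI1)
      next
        case False
        then have "\<not> card (D - {d}) \<le> Suc 0" using cD by linarith
        then have "\<not> (\<forall>i\<in>D - {d}. \<forall>j\<in>D - {d}. i = j)"
          using card_le_Suc0_iff_eq[of "D - {d}"] less.prems(1) by simp
        then obtain i j where ij: "i \<in> D - {d}" "j \<in> D - {d}" "i \<noteq> j" by blast
        \<comment> \<open>The crossing point \<open>flip i s\<close> is bad if the path in either
          half would have the two ends of \<open>f\<close> as its ends. Since \<open>f\<close> can
          be only one of these edges, it spoils at most one of the two candidates \<open>i\<close>
          and \<open>j\<close>.\<close>
        have "\<not> ({s, flip i s} = f \<and> {flip d (flip j s), t} = f)"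
          "\<not> ({s, flip j s} = f \<and> {flip d (flip i s), t} = f)"
          using d(2) ij by (auto simp: doubleton_eq_iff)
        moreover have "{s, flip i s} \<noteq> {s, flip j s}"
          "{flip d (flip i s), t} \<noteq> {flip d (flip j s), t}"
          using ij by (auto simp: doubleton_eq_iff)
        ultimately have "({s, flip i s} \<noteq> f \<and> {flip d (flip i s), t} \<noteq> f) \<or>
            ({s, flip j s} \<noteq> f \<and> {flip d (flip j s), t} \<noteq> f)" by metis
        then show ?thesis using that[of i] that[of j] ij less.prems(6) by blast
      qed
      let ?y = "flip i s"
      have P: "ham_path ?A (F \<inter> {e. e \<subseteq> ?A}) s ?y"
        using d(1) i less.prems by (intro IH) (auto simp: even_card_flip)
      have eqB: "cube (D - {d}) (flip d ?y) = ?B"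
        by (rule cube_eq) (use i in \<open>simp add: flip_commute[of d]\<close>)
      have "ham_path (cube (D - {d}) (flip d ?y)) (F \<inter> {e. e \<subseteq> ?B}) (flip d ?y) t"
        using d(1) i less.prems tB eqB by (intro IH) (auto simp: even_card_flip)
      from ham_path_join[OF P this[unfolded eqB] cube_disjoint[OF d(1)]]
      have "ham_path (?A \<union> ?B) (insert {?y, flip d ?y} (F \<inter> {e. e \<subseteq> ?A} \<union> F \<inter> {e. e \<subseteq> ?B})) s t"
        by simp
      then show ?thesis unfolding cube_split[OF d(1)] by (rule ham_path_mono) (use F in auto)
    next
      case no: False
      \<comment> \<open>From here on, every direction separating \<open>s\<close> from
        \<open>t\<close> is the direction of \<open>f\<close>. As an edge has a single direction,
        \<open>s\<close> and \<open>t\<close> are adjacent.\<close>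
      have dir: "\<exists>x\<in>cube (D - {d}) s. F = {{x, flip d x}} \<and> f = {x, flip d x}"
        if "d \<in> D" "(d \<in> t) \<noteq> (d \<in> s)" for d
      proof -
        have "t \<notin> cube (D - {d}) s" using that by (simp add: cube_Diff_mem)
        with no that(1) obtain e where e: "e \<in> F" "\<not> e \<subseteq> cube (D - {d}) s"
          "\<not> e \<subseteq> cube (D - {d}) (flip d s)" by blast
        have "e \<in> cube_edges" using e(1) less.prems(7) by (rule rev_subsetD)
        from cube_edge_split[OF this less.prems(8)[OF e(1)] that(1)] e
        obtain x where "x \<in> cube (D - {d}) s" "e = {x, flip d x}" by blast
        moreover have "F = {f}" "e = f" using e(1) less.prems(6) by auto
        ultimately show ?thesis by blast
      qed
      have "t \<noteq> s" using less.prems by auto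
      then obtain d where d: "d \<in> D" "(d \<in> t) \<noteq> (d \<in> s)" using less.prems(4) by (auto simp: mem_cube)
      from dir[OF this] obtain x where x: "x \<in> cube (D - {d}) s" "F = {f}" "f = {x, flip d x}" by auto
      have "(k \<in> t) = (k \<in> s)" if "k \<noteq> d" for k
      proof (cases "k \<in> D")
        case True
        show ?thesis
        proof (rule ccontr)
          assume "(k \<in> t) \<noteq> (k \<in> s)"
          from dir[OF True this] x show False using cube_edge_dir_eq that by metis
        qed
      qed (use less.prems(4) in \<open>auto simp: mem_cube\<close>)
      then have t: "t = flip d s" using d by (auto simp: mem_flip)
      \<comment> \<open>The edge \<open>f\<close> is parallel to \<open>st\<close> but different
        from it, so some direction \<open>e\<close> puts the two edges into opposite halves.\<close>
      have "x \<noteq> s" using x t less.prems(9) False by auto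
      then obtain e where e: "e \<in> D - {d}" "(e \<in> x) \<noteq> (e \<in> s)" using x(1) by (auto simp: mem_cube)
      let ?A = "cube (D - {e}) s" and ?B = "cube (D - {e}) (flip e s)"
      have xD: "x \<in> cube D s" using x(1) d(1) by (auto simp: cube_Diff_mem)
      have fB: "f \<subseteq> ?B" using e x xD d(1) by (auto simp: cube_Diff_mem cube_flip mem_flip)
      have "ham_path ?A {} s t"
        using e less.prems d t by (intro IH) auto
      then obtain xs where xs: "xs \<noteq> []" "hd xs = s" "last xs = t" "distinct xs" "set xs = ?A"
        "path_edges xs \<subseteq> cube_edges" unfolding ham_path_def by blast
      have splice: ?thesis if "xs = ps @ qs" "ps \<noteq> []" "qs \<noteq> []"
        "{flip e (last ps), flip e (hd qs)} \<noteq> f \<or> card (D - {e}) = 1" for ps qs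
      proof -
        have "last ps \<in> set xs" "hd qs \<in> set xs" using that(1-3) by simp_all
        then have u: "last ps \<in> ?A" "hd qs \<in> ?A" unfolding xs(5) .
        have eqB: "cube (D - {e}) (flip e (last ps)) = ?B" using u by (intro cube_eq) auto
        have "{last ps, hd qs} \<in> cube_edges" using xs(6) that by (auto simp: path_edges_append)
        then obtain k where k: "hd qs = flip k (last ps)" by (auto simp: cube_edge_iff)
        have fin: "finite (last ps)" using u less.prems by (auto intro: finite_mem_cube)
        have "ham_path (cube (D - {e}) (flip e (last ps))) F (flip e (last ps)) (flip e (hd qs))"
          using that e u fB x(2) eqB fin k by (intro IH) (auto simp: even_card_flip)
        from ham_path_splice[of ps qs ?A ?B F e "{}", OF _ _ _ _ _ _ this[unfolded eqB]]
        have "ham_path (?A \<union> ?B) ({{last ps, flip e (last ps)}, {hd qs, flip e (hd qs)}} \<union> {} \<union> F)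
            (hd ps) (last qs)"
          using that xs e cube_disjoint[of e D s] by (auto simp: path_edges_append)
        moreover have "hd ps = s" "last qs = t" using that xs by auto
        moreover have "cube D s = ?A \<union> ?B" using e by (intro cube_split) auto
        ultimately show ?thesis by (auto elim: ham_path_mono)
      qed
      have lenxs: "length xs = 2 ^ card (D - {e})"
        using xs(4,5) distinct_card card_cube less.prems(1) by (metis finite_Diff)
      have cDe: "card (D - {e}) = card D - 1" using e less.prems by simp
      show ?thesis
      proof (cases "card (D - {e}) = 1")
        case True
        then have "length xs = 2" using lenxs by simp
        then obtain g h where "xs = [g] @ [h]" by (auto simp: length_Suc_conv numeral_2_eq_2)
        then show ?thesis using splice True by blast
      next
        case False
        then have "(2::nat) ^ 2 \<le> 2 ^ card (D - {e})" using card cDe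
          by (intro power_increasing) auto
        then have "length xs \<ge> 3" using lenxs by simp
        \<comment> \<open>Two consecutive edges have different mirror images in the other half, so
          at least one image differs from \<open>f\<close>, and the path can be cut at that
          edge.\<close>
        then obtain g h k us where xs': "xs = g # h # k # us"
          by (auto simp: Suc_le_length_iff numeral_3_eq_3)
        show ?thesis
        proof (cases "{flip e g, flip e h} = f")
          case True
          then have "{flip e h, flip e k} \<noteq> f" using xs(4) xs' by (auto simp: doubleton_eq_iff)
          then show ?thesis using splice[of "[g, h]" "k # us"] xs' by auto
        next
          case False
          then show ?thesis using splice[of "[g]" "h # k # us"] xs' by auto
        qed
      qed
    qed
  qed
qed

section \<open>Fink's theorem\<close>

text \<open>A perfect matching of the complete graph on \<open>V\<close>: the pairs need not be cube
  edges. This generality is what the induction for Fink's theorem requires, since pairs of vertices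
  are regrouped arbitrarily in each half.\<close>

definition pairing :: "('a \<Rightarrow> 'a) \<Rightarrow> 'a set \<Rightarrow> bool" where
  "pairing p V \<longleftrightarrow> (\<forall>x\<in>V. p x \<in> V \<and> p x \<noteq> x \<and> p (p x) = x)"

lemma pairingD: "pairing p V \<Longrightarrow> x \<in> V \<Longrightarrow> p x \<in> V \<and> p x \<noteq> x \<and> p (p x) = x"
  by (simp add: pairing_def)

lemma even_card_pairing: "finite V \<Longrightarrow> pairing p V \<Longrightarrow> even (card V)"
proof (induction "card V" arbitrary: V rule: less_induct)
  case less
  show ?case
  proof (cases "V = {}")
    case False
    then obtain x where x: "x \<in> V" by blast
    note px = pairingD[OF less.prems(2) x]
    have p: "pairing p (V - {x, p x})" using less.prems(2) px x unfolding pairing_def by (metis Diff_iff insert_iff singletonD)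
    have c: "card (V - {x, p x}) = card V - 2" using px x less.prems(1) by (subst card_Diff_subset) auto
    have "card {x, p x} \<le> card V" using px x less.prems(1) by (intro card_mono) auto
    moreover have "x \<noteq> p x" using px by metis
    ultimately have "card V \<ge> 2" by simp
    then show ?thesis using less.hyps[of "V - {x, p x}"] c p less.prems(1) by auto
  qed auto
qed

lemma pairing_exists:
  assumes "finite V" "even (card V)"
  obtains p where "pairing p V"
  using assms
proof (induction "card V" arbitrary: V thesis rule: less_induct)
  case less
  show ?case
  proof (cases "V = {}")
    case True
    then show ?thesis using less.prems(1) by (simp add: pairing_def)
  next
    case False
    then obtain x where x: "x \<in> V" by blast
    have "V \<noteq> {x}" using less.prems(3) by auto
    with x obtain y where y: "y \<in> V" "y \<noteq> x" by blast
    have c: "card (V - {x, y}) = card V - 2" using y x less.prems(2) by (subst card_Diff_subset) auto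
    have "card {x, y} \<le> card V" using y x less.prems(2) by (intro card_mono) auto
    then have "card V \<ge> 2" using y by (simp split: if_splits)
    then obtain p where p: "pairing p (V - {x, y})"
      using less.hyps[of "V - {x, y}"] c less.prems(2,3) by auto
    show ?thesis
      by (rule less.prems(1)[of "p(x := y, y := x)"]) (use p x y in \<open>auto simp: pairing_def\<close>)
  qed
qed

text \<open>An alternating walk from \<open>t\<close> to \<open>e\<close> that begins and ends with
  a cube edge; \<open>L\<close> records the vertex at which each pair is entered, and the pair is
  left at the partner.\<close>

fun chain :: "(nat set \<Rightarrow> nat set) \<Rightarrow> nat set \<Rightarrow> nat set list \<Rightarrow> nat set \<Rightarrow> bool" where
  "chain p t [] e \<longleftrightarrow> {t, e} \<in> cube_edges"
| "chain p t (x # L) e \<longleftrightarrow> {t, x} \<in> cube_edges \<and> chain p (p x) L e"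

lemma chain_append: "chain p t (L @ x # K) e \<longleftrightarrow> chain p t L x \<and> chain p (p x) K e"
  by (induction L arbitrary: t) auto

lemma chain_rev:
  "chain p t L e \<Longrightarrow> (\<And>x. x \<in> set L \<Longrightarrow> p (p x) = x) \<Longrightarrow> chain p e (rev (map p L)) t"
  by (induction L arbitrary: t) (auto simp: insert_commute chain_append)

text \<open>\<open>L\<close> lists one end \<open>x\<close> of each pair; the cycle goes from \<open>x\<close> to \<open>p x\<close> and then along a cube edge to
  the next entry of \<open>L\<close>.\<close>

definition alternating :: "nat set set \<Rightarrow> (nat set \<Rightarrow> nat set) \<Rightarrow> nat set list \<Rightarrow> bool" where
  "alternating V p L \<longleftrightarrow> L \<noteq> [] \<and> chain p (p (hd L)) (tl L) (hd L) \<and>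
     distinct (L @ map p L) \<and> set (L @ map p L) = V"

text \<open>A block \<open>(t, L, e)\<close> stands for a segment from \<open>t\<close> to
  \<open>e\<close> that runs through the pairs of \<open>L\<close>. The order of the listed vertices
  is immaterial: they serve only to check, by multisets, that nothing is lost or repeated.\<close>

definition block_verts :: "('a \<Rightarrow> 'a) \<Rightarrow> 'a \<times> 'a list \<times> 'a \<Rightarrow> 'a list" where
  "block_verts p b = (case b of (t, L, e) \<Rightarrow> [t, e] @ L @ map p L)"

lemma block_verts_simp: "block_verts p (t, L, e) = [t, e] @ L @ map p L"
  by (simp add: block_verts_def)

text \<open>Each entry \<open>x\<close> in \<open>T\<close> ends one segment and \<open>q x\<close>
  starts the next. The first segment is kept apart because its start \<open>t\<close> is arbitrary
  in the induction, whereas all later starts lie in \<open>T\<close>. Between cuts \<open>q\<close>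
  agrees with \<open>p\<close>, so the segments are walks for \<open>p\<close>.\<close>

lemma chain_blocks:
  assumes "chain q t L e" "e \<in> T" "\<And>x. x \<in> set L \<Longrightarrow> x \<in> T \<Longrightarrow> q x \<in> T"
    "\<And>x. x \<in> set L \<Longrightarrow> x \<notin> T \<Longrightarrow> q x = p x"
  shows "\<exists>L1 e1 bs. (\<forall>b\<in>set bs. fst b \<in> T) \<and>
    (\<forall>(t', L', e')\<in>set ((t, L1, e1) # bs). chain p t' L' e' \<and> set L' \<inter> T = {} \<and> e' \<in> T) \<and>
    mset (concat (map (block_verts p) ((t, L1, e1) # bs))) = mset ([t, e] @ L @ map q L)"
  using assms
proof (induction L arbitrary: t)
  case Nil
  then show ?case by (intro exI[of _ "[]"] exI[of _ e]) (auto simp: block_verts_simp)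
next
  case (Cons x L)
  have "\<exists>L1 e1 bs. (\<forall>b\<in>set bs. fst b \<in> T) \<and>
    (\<forall>(t', L', e')\<in>set ((q x, L1, e1) # bs). chain p t' L' e' \<and> set L' \<inter> T = {} \<and> e' \<in> T) \<and>
    mset (concat (map (block_verts p) ((q x, L1, e1) # bs))) = mset ([q x, e] @ L @ map q L)"
    by (rule Cons.IH) (use Cons.prems in auto)
  then obtain L1 e1 bs where IH: "\<forall>b\<in>set bs. fst b \<in> T"
    "\<forall>(t', L', e')\<in>set ((q x, L1, e1) # bs). chain p t' L' e' \<and> set L' \<inter> T = {} \<and> e' \<in> T"
    "mset (concat (map (block_verts p) ((q x, L1, e1) # bs))) = mset ([q x, e] @ L @ map q L)"
    by (elim exE conjE)
  show ?case
  proof (cases "x \<in> T")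
    case True
    then have "q x \<in> T" using Cons.prems by simp
    then show ?thesis using True IH Cons.prems(1)
      by (intro exI[of _ "[] :: nat set list"] exI[of _ x] exI[of _ "(q x, L1, e1) # bs"])
        (auto simp: block_verts_simp)
  next
    case False
    then have "q x = p x" using Cons.prems by simp
    then show ?thesis using IH Cons.prems False
      by (intro exI[of _ "x # L1"] exI[of _ e1] exI[of _ bs]) (auto simp: block_verts_simp)
  qed
qed

lemma distinct_concat_disjoint:
  assumes "distinct (concat (map f bs))" "b \<in> set bs" "c \<in> set bs" "x \<in> set (f b)" "x \<in> set (f c)"
  shows "b = c"
  using assms by (induction bs) auto

lemma distinct_concat_map:
  assumes "distinct L" "\<And>x. x \<in> set L \<Longrightarrow> distinct (h x)"
    "\<And>x y. x \<in> set L \<Longrightarrow> y \<in> set L \<Longrightarrow> x \<noteq> y \<Longrightarrow> set (h x) \<inter> set (h y) = {}"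
  shows "distinct (concat (map h L))"
  using assms
proof (induction L)
  case (Cons x L)
  have "distinct (concat (map h L))" using Cons.prems by (intro Cons.IH) auto
  moreover have "set (h x) \<inter> set (h y) = {}" if "y \<in> set L" for y
    using Cons.prems(1) that by (intro Cons.prems(3)) auto
  ultimately show ?case using Cons.prems(2)[of x] by auto
qed auto

lemma alternating_rotate:
  assumes "alternating V p L" "y \<in> set L"
  obtains M where "alternating V p (y # M)"
proof -
  from assms(2) obtain u v where L: "L = u @ y # v" by (meson split_list)
  have "chain p (p y) (v @ u) y"
    using assms(1) by (cases u) (auto simp: L alternating_def chain_append)
  moreover have "distinct ((y # v @ u) @ map p (y # v @ u)) \<longleftrightarrow> distinct (L @ map p L)"
    by (rule mset_eq_imp_distinct_iff) (simp add: L)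
  moreover have "set ((y # v @ u) @ map p (y # v @ u)) = set (L @ map p L)"
    by (auto simp: L)
  ultimately have "alternating V p (y # v @ u)"
    using assms(1) by (simp add: alternating_def del: distinct_append set_append)
  then show thesis using that by blast
qed

text \<open>Removing the pairs inside \<open>T\<close> cuts the cycle into segments with ends in \<open>T\<close>: the one starting at \<open>t\<close>
  ends at \<open>en t\<close> and has the pairs of \<open>lk t\<close> in between.\<close>

lemma alternating_cut:
  assumes q: "pairing q A" and alt: "alternating A q L" and T: "T \<subseteq> A" "T \<noteq> {}"
    and qT: "\<And>x. x \<in> T \<Longrightarrow> q x \<in> T" and qp: "\<And>x. x \<in> A \<Longrightarrow> x \<notin> T \<Longrightarrow> q x = p x"
  obtains lk en where "\<And>t. t \<in> T \<Longrightarrow> en t \<in> T \<and> en t \<noteq> t \<and> en (en t) = t \<and> chain p t (lk t) (en t)"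
    "\<And>t. t \<in> T \<Longrightarrow> distinct (block_verts p (t, lk t, en t))"
    "\<And>t. t \<in> T \<Longrightarrow> set (block_verts p (en t, lk (en t), en (en t))) = set (block_verts p (t, lk t, en t))"
    "\<And>t u x. t \<in> T \<Longrightarrow> u \<in> T \<Longrightarrow> x \<in> set (block_verts p (t, lk t, en t)) \<Longrightarrow>
      x \<in> set (block_verts p (u, lk u, en u)) \<Longrightarrow> u = t \<or> u = en t"
    "A = (\<Union>t\<in>T. set (block_verts p (t, lk t, en t)))"
proof -
  obtain a where a: "a \<in> T" using T(2) by blast
  have "a \<in> set (L @ map q L)" using a T(1) alt by (auto simp: alternating_def)
  then obtain y where y: "y \<in> set L" "y = a \<or> q y = a" by auto
  have yA: "y \<in> A" using y(1) alt by (auto simp: alternating_def)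
  have yT: "y \<in> T" using y(2) a pairingD[OF q yA] qT[of a] by metis
  \<comment> \<open>The cycle is opened at a pair inside \<open>T\<close>, so that the first segment
    also starts in \<open>T\<close>, at \<open>q y\<close>.\<close>
  obtain M where "alternating A q (y # M)" using alternating_rotate[OF alt y(1)] .
  then have M: "chain q (q y) M y" "distinct ((y # M) @ map q (y # M))" "set ((y # M) @ map q (y # M)) = A"
    by (simp_all add: alternating_def del: distinct_append set_append)
  have MA: "set M \<subseteq> A" using M(3) by auto
  have "\<exists>L1 e1 bs. (\<forall>b\<in>set bs. fst b \<in> T) \<and>
    (\<forall>(t', L', e')\<in>set ((q y, L1, e1) # bs). chain p t' L' e' \<and> set L' \<inter> T = {} \<and> e' \<in> T) \<and>
    mset (concat (map (block_verts p) ((q y, L1, e1) # bs))) = mset ([q y, y] @ M @ map q M)"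
    by (rule chain_blocks) (use M(1) yT qT qp MA in auto)
  then obtain L1 e1 bs' where bs': "\<forall>b\<in>set bs'. fst b \<in> T"
    "\<forall>(t', L', e')\<in>set ((q y, L1, e1) # bs'). chain p t' L' e' \<and> set L' \<inter> T = {} \<and> e' \<in> T"
    "mset (concat (map (block_verts p) ((q y, L1, e1) # bs'))) = mset ([q y, y] @ M @ map q M)"
    by (elim exE conjE)
  define bs where "bs = (q y, L1, e1) # bs'"
  have eq: "mset (concat (map (block_verts p) bs)) = mset ((y # M) @ map q (y # M))"
    using bs'(3) unfolding bs_def by simp
  have dist: "distinct (concat (map (block_verts p) bs))"
    using mset_eq_imp_distinct_iff[OF eq] M(2) by blast
  have cover: "set (concat (map (block_verts p) bs)) = A"
    using mset_eq_setD[OF eq] M(3) by blast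
  have blk: "t \<in> T \<and> e \<in> T \<and> chain p t L e \<and> set L \<inter> T = {}" if "(t, L, e) \<in> set bs" for t L e
    using bs'(1,2) qT[OF yT] that unfolding bs_def by fastforce
  have LA: "x \<in> A \<and> x \<notin> T \<and> p x \<in> A \<and> p x \<notin> T \<and> p (p x) = x" if "(t, L, e) \<in> set bs" "x \<in> set L" for t L e x
  proof -
    have x: "x \<in> A" "x \<notin> T" using cover that blk[OF that(1)] by (force simp: block_verts_simp)+
    have "q x \<notin> T" using qT[of "q x"] x pairingD[OF q x(1)] by metis
    then show ?thesis using x pairingD[OF q x(1)] qp[OF x] qp[of "q x"] by metis
  qed
  \<comment> \<open>Each segment is kept in both orientations, so that every vertex of
    \<open>T\<close> is the start of some segment.\<close>
  define rv where "rv b = (case b of (t, L, e) \<Rightarrow> (e, rev (map p L), t))"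
    for b :: "nat set \<times> nat set list \<times> nat set"
  define OB where "OB = set bs \<union> rv ` set bs"
  have rv_rv: "rv (rv b) = b" if "b \<in> set bs" for b
  proof -
    obtain t L e where b: "b = (t, L, e)" by (cases b)
    have "map (p \<circ> p) L = L" using LA[of t L e] that b by (intro map_idI) auto
    then show ?thesis by (simp add: rv_def b rev_map)
  qed
  have verts_rv: "set (block_verts p (rv b)) = set (block_verts p b)"
    "distinct (block_verts p (rv b)) \<longleftrightarrow> distinct (block_verts p b)" if "b \<in> set bs" for b
  proof -
    obtain t L e where b: "b = (t, L, e)" by (cases b)
    have "map (p \<circ> p) L = L" using LA[of t L e] that b by (intro map_idI) auto
    then have "image_mset (p \<circ> p) (mset L) = mset L" by (metis mset_map)
    then have "mset (block_verts p (rv b)) = mset (block_verts p b)"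
      by (simp add: rv_def b block_verts_simp rev_map)
    then show "set (block_verts p (rv b)) = set (block_verts p b)"
      "distinct (block_verts p (rv b)) \<longleftrightarrow> distinct (block_verts p b)"
      by (auto dest: mset_eq_setD mset_eq_imp_distinct_iff)
  qed
  have OB_cases: "\<exists>b\<in>set bs. c = b \<or> c = rv b" if "c \<in> OB" for c
    using that unfolding OB_def by blast
  have OB_verts: "set (block_verts p (rv c)) = set (block_verts p c)" if "c \<in> OB" for c
    using OB_cases[OF that] verts_rv(1) rv_rv by metis
  have OB_chain: "e \<in> T \<and> chain p t L e" if tLe: "(t, L, e) \<in> OB" for t L e
  proof -
    obtain b where b: "b \<in> set bs" "(t, L, e) = b \<or> (t, L, e) = rv b" using OB_cases[OF tLe] by blast
    obtain t' L' e' where b': "b = (t', L', e')" by (cases b)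
    note blk' = blk[OF b(1)[unfolded b']]
    have "chain p e' (rev (map p L')) t'"
      by (rule chain_rev) (use blk' LA[OF b(1)[unfolded b']] in auto)
    then show ?thesis using b(2) blk' by (auto simp: b' rv_def)
  qed
  have OB_distinct: "distinct (block_verts p c)" if c: "c \<in> OB" for c
  proof -
    obtain b where "b \<in> set bs" "c = b \<or> c = rv b" using OB_cases[OF c] by blast
    moreover from this have "distinct (block_verts p b)" using dist by (simp add: distinct_concat_iff)
    ultimately show ?thesis using verts_rv(2) by metis
  qed
  have OB_meet: "c' = c \<or> c' = rv c"
    if o: "c \<in> OB" "c' \<in> OB" and x: "x \<in> set (block_verts p c)" "x \<in> set (block_verts p c')" for c c' x
  proof -
    obtain b where b: "b \<in> set bs" "c = b \<or> c = rv b" using OB_cases[OF o(1)] by blast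
    obtain b' where b': "b' \<in> set bs" "c' = b' \<or> c' = rv b'" using OB_cases[OF o(2)] by blast
    have "x \<in> set (block_verts p b)" "x \<in> set (block_verts p b')"
      using b b' x verts_rv(1) by metis+
    then have "b = b'" using distinct_concat_disjoint[OF dist b(1) b'(1)] by blast
    then show ?thesis using b b' rv_rv by metis
  qed
  have ex: "\<exists>L e. (t, L, e) \<in> OB" if "t \<in> T" for t
  proof -
    have "t \<in> set (concat (map (block_verts p) bs))" using that T(1) cover by blast
    then obtain t' L' e' where b: "(t', L', e') \<in> set bs" "t \<in> set (block_verts p (t', L', e'))" by auto
    then have "t = t' \<or> t = e'" using LA[OF b(1)] that by (auto simp: block_verts_simp)
    then show ?thesis using b(1) unfolding OB_def rv_def by force
  qed
  define lk where "lk t = fst (SOME b. (t, fst b, snd b) \<in> OB)" for t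
  define en where "en t = snd (SOME b. (t, fst b, snd b) \<in> OB)" for t
  have OB: "(t, lk t, en t) \<in> OB" if "t \<in> T" for t
    using someI_ex[of "\<lambda>b. (t, fst b, snd b) \<in> OB"] ex[OF that] by (force simp: lk_def en_def)
  have neq: "en t \<noteq> t" if "t \<in> T" for t
    using OB_distinct[OF OB[OF that]] by (auto simp: block_verts_simp)
  have meet: "u = t \<or> u = en t"
    if "t \<in> T" "u \<in> T" "x \<in> set (block_verts p (t, lk t, en t))" "x \<in> set (block_verts p (u, lk u, en u))" for t u x
    using OB_meet[OF OB[OF that(1)] OB[OF that(2)] that(3,4)] by (auto simp: rv_def)
  \<comment> \<open>Oriented segments that share a vertex are equal or reverse to each other. Hence
    the segment chosen at \<open>en t\<close> can only be the reverse of the one chosen at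
    \<open>t\<close>.\<close>
  have enen: "lk (en t) = rev (map p (lk t)) \<and> en (en t) = t" if t: "t \<in> T" for t
  proof -
    have "en t \<in> T" using OB_chain OB t by blast
    from OB_meet[OF OB[OF t] OB[OF this], of "en t"]
    show ?thesis using neq[OF t] by (auto simp: block_verts_simp rv_def)
  qed
  show thesis
  proof (rule that[of en lk])
    show "set (block_verts p (en t, lk (en t), en (en t))) = set (block_verts p (t, lk t, en t))"
      if t: "t \<in> T" for t
      using OB_verts[OF OB[OF t]] enen[OF t] by (simp add: rv_def)
    show "A = (\<Union>t\<in>T. set (block_verts p (t, lk t, en t)))"
    proof
      show "A \<subseteq> (\<Union>t\<in>T. set (block_verts p (t, lk t, en t)))"
      proof
        fix x assume "x \<in> A"
        then obtain t L e where b: "(t, L, e) \<in> set bs" "x \<in> set (block_verts p (t, L, e))"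
          using cover by auto
        have t: "t \<in> T" using blk[OF b(1)] by blast
        have "(t, L, e) \<in> OB" using b(1) by (simp add: OB_def)
        from OB_meet[OF this OB[OF t], of t] have "L = lk t \<and> e = en t"
          using neq[OF t] by (auto simp: block_verts_simp rv_def)
        then show "x \<in> (\<Union>t\<in>T. set (block_verts p (t, lk t, en t)))" using b(2) t by blast
      qed
      show "(\<Union>t\<in>T. set (block_verts p (t, lk t, en t))) \<subseteq> A"
      proof
        fix x assume "x \<in> (\<Union>t\<in>T. set (block_verts p (t, lk t, en t)))"
        then obtain t where "t \<in> T" "x \<in> set (block_verts p (t, lk t, en t))" by blast
        moreover obtain b where "b \<in> set bs" "(t, lk t, en t) = b \<or> (t, lk t, en t) = rv b"
          using OB_cases[OF OB[OF \<open>t \<in> T\<close>]] by blast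
        ultimately have "b \<in> set bs" "x \<in> set (block_verts p b)"
          using verts_rv(1) by metis+
        then show "x \<in> A" using cover by auto
      qed
    qed
  qed (use OB OB_chain OB_distinct neq enen meet in blast)+
qed

text \<open>Fink's argument: choose a direction crossed by some pair, let \<open>T\<close> be the ends of the crossing pairs in
  one half \<open>A\<close> and pair them up arbitrarily. The induction hypothesis for \<open>A\<close> gives segments joining the
  vertices of \<open>T\<close>; these prescribe how to pair the opposite ends in the other half \<open>B\<close>. In the cycle
  obtained for \<open>B\<close>, each prescribed pair is replaced by the corresponding segment.\<close>

theorem pairing_extends:
  assumes "finite D" "D \<noteq> {}" "pairing p (cube D a)"
  shows "\<exists>L. alternating (cube D a) p L"
  using assms
proof (induction "card D" arbitrary: D a p rule: less_induct)
  case less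
  let ?V = "cube D a"
  note pV = pairingD[OF less.prems(3)]
  show ?case
  proof (cases "card D = 1")
    case True
    then obtain i where "D = {i}" by (auto simp: card_1_singleton_iff)
    then have V: "?V = {a, flip i a}" by (simp add: cube_singleton)
    then have "p a = flip i a" using pV[of a] by auto
    then have "alternating ?V p [a]" using V by (simp add: alternating_def)
    then show ?thesis by blast
  next
    case False
    have "p a \<noteq> a" "p a \<in> ?V" using pV[of a] by auto
    \<comment> \<open>Since the pair of \<open>a\<close> crosses direction \<open>d\<close>, the set
      \<open>T\<close> below is nonempty; without a cut, the cycle of \<open>A\<close> could not be
      opened and attached to \<open>B\<close>.\<close>
    then obtain d where d: "d \<in> D" "(d \<in> p a) \<noteq> (d \<in> a)" by (auto simp: mem_cube)
    let ?A = "cube (D - {d}) a" and ?B = "cube (D - {d}) (flip d a)"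
    have V: "?V = ?A \<union> ?B" and AB: "?A \<inter> ?B = {}"
      using cube_split[OF d(1)] cube_disjoint[OF d(1)] by blast+
    have cD: "card (D - {d}) < card D" "D - {d} \<noteq> {}" "finite (D - {d})"
      using card_Diff1_less[OF less.prems(1) d(1)] d(1) False less.prems(1)
      by (auto simp: card_1_singleton_iff)
    define T where "T = {x \<in> ?A. p x \<in> ?B}"
    have aT: "a \<in> T" using d \<open>p a \<in> ?V\<close> by (simp add: T_def cube_Diff_mem cube_flip mem_flip)
    have TA: "T \<subseteq> ?A" by (auto simp: T_def)
    \<comment> \<open>This shows that \<open>T\<close> has even size, so its vertices can be paired
      up: the rest of \<open>A\<close> is paired by \<open>p\<close>, and \<open>A\<close> has even
      size because a direction remains.\<close>
    have "pairing p (?A - T)" unfolding pairing_def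
    proof
      fix x assume x: "x \<in> ?A - T"
      then have "p x \<in> ?V" "p x \<noteq> x" "p (p x) = x" using pV[of x] V by auto
      moreover from this x have "p x \<in> ?A" using V by (auto simp: T_def)
      moreover from calculation x have "p x \<notin> T" using AB by (auto simp: T_def)
      ultimately show "p x \<in> ?A - T \<and> p x \<noteq> x \<and> p (p x) = x" by blast
    qed
    then have "even (card (?A - T))" using finite_cube[OF cD(3)] by (intro even_card_pairing) auto
    moreover have "even (card ?A)" using card_cube[OF cD(3)] cD by (simp add: card_gt_0_iff)
    moreover have "card ?A = card (?A - T) + card T"
      using TA finite_cube[OF cD(3)] by (metis card_Diff_subset card_mono finite_subset le_add_diff_inverse2)
    ultimately have "even (card T)" by simp
    then obtain s where s: "pairing s T"
      using pairing_exists finite_subset[OF TA finite_cube[OF cD(3)]] by blast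
    define q where "q x = (if x \<in> T then s x else p x)" for x
    have q: "pairing q ?A" unfolding pairing_def
    proof
      fix x assume x: "x \<in> ?A"
      show "q x \<in> ?A \<and> q x \<noteq> x \<and> q (q x) = x"
      proof (cases "x \<in> T")
        case True
        then show ?thesis using pairingD[OF s True] TA by (auto simp: q_def)
      next
        case False
        then show ?thesis using pairingD[OF \<open>pairing p (?A - T)\<close>, of x] x by (simp add: q_def)
      qed
    qed
    obtain L0 where L0: "alternating ?A q L0"
      using less.hyps[OF cD(1,3,2) q] by blast
    obtain lk en where en: "\<And>t. t \<in> T \<Longrightarrow> en t \<in> T \<and> en t \<noteq> t \<and> en (en t) = t \<and> chain p t (lk t) (en t)"
      and dist: "\<And>t. t \<in> T \<Longrightarrow> distinct (block_verts p (t, lk t, en t))"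
      and sym: "\<And>t. t \<in> T \<Longrightarrow>
        set (block_verts p (en t, lk (en t), en (en t))) = set (block_verts p (t, lk t, en t))"
      and meet: "\<And>t u x. t \<in> T \<Longrightarrow> u \<in> T \<Longrightarrow> x \<in> set (block_verts p (t, lk t, en t)) \<Longrightarrow>
        x \<in> set (block_verts p (u, lk u, en u)) \<Longrightarrow> u = t \<or> u = en t"
      and cover: "?A = (\<Union>t\<in>T. set (block_verts p (t, lk t, en t)))"
    proof (rule alternating_cut[OF q L0 TA])
      show "q x \<in> T" if "x \<in> T" for x using pairingD[OF s that] that by (simp add: q_def)
      show "q x = p x" if "x \<notin> T" for x using that by (simp add: q_def)
    qed (use aT in auto)
    have TB: "p y \<in> T" if "y \<in> ?B" "p y \<in> ?A" for y
      using that pV[of y] V by (auto simp: T_def)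
    have BT: "p t \<in> ?B" "p (p t) = t" if "t \<in> T" for t
      using that pV[of t] V by (auto simp: T_def)
    \<comment> \<open>A jump from \<open>y\<close> to \<open>r y\<close> abbreviates the route from
      \<open>y\<close> to \<open>p y\<close> in \<open>A\<close>, along the segment to
      \<open>en (p y)\<close>, and back to \<open>B\<close> by \<open>p\<close>.\<close>
    define r where "r y = (if p y \<in> ?A then p (en (p y)) else p y)" for y
    have r: "pairing r ?B" unfolding pairing_def
    proof
      fix y assume y: "y \<in> ?B"
      then have y': "p y \<in> ?V" "p y \<noteq> y" "p (p y) = y" using pV[of y] V by auto
      show "r y \<in> ?B \<and> r y \<noteq> y \<and> r (r y) = y"
      proof (cases "p y \<in> ?A")
        case True
        note t = TB[OF y True]
        have "p (en (p y)) \<noteq> y" using en[OF t] BT(2)[of "en (p y)"] by metis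
        moreover have "en (p y) \<in> ?A" using en[OF t] TA by blast
        ultimately show ?thesis using en[OF t] BT[of "en (p y)"] True y' by (simp add: r_def)
      next
        case False
        then have "p y \<in> ?B" using y'(1) V by (metis UnE)
        moreover have "y \<notin> ?A" using y AB by blast
        ultimately show ?thesis using False y' by (simp add: r_def)
      qed
    qed
    obtain L1 where L1: "alternating ?B r L1"
      using less.hyps[OF cD(1,3,2) r] by blast
    \<comment> \<open>The abbreviated jump written out: the pair of \<open>y\<close>, the pairs
      inside the segment, and finally the pair entered at \<open>en (p y)\<close>, which is left at
      \<open>r y\<close>.\<close>
    define g where "g y = (if p y \<in> ?A then y # lk (p y) @ [en (p y)] else [y])" for y
    have g_Cons: "g y = y # tl (g y)" for y by (simp add: g_def)
    have chain_g: "chain p (p y) (tl (g y) @ K) e" if "chain p (r y) K e" "y \<in> ?B" for y K e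
    proof (cases "p y \<in> ?A")
      case True
      then have "chain p (p y) (lk (p y)) (en (p y))" using en[OF TB[OF that(2)]] by blast
      then show ?thesis using True that(1) by (simp add: g_def r_def chain_append)
    next
      case False
      then show ?thesis using that(1) by (simp add: g_def r_def)
    qed
    have chain_concat: "chain p t (concat (map g K)) e" if "chain r t K e" "set K \<subseteq> ?B" for t K e
      using that
    proof (induction K arbitrary: t)
      case (Cons y K)
      then have "chain p (p y) (tl (g y) @ concat (map g K)) e"
        by (intro chain_g Cons.IH) auto
      then have "chain p t (y # tl (g y) @ concat (map g K)) e" using Cons.prems by simp
      then show ?case using g_Cons[of y] by (metis append_Cons concat.simps(2) list.simps(9))
    qed auto
    define h where "h y = g y @ map p (g y)" for y
    let ?L = "concat (map g L1)"
    have L1': "L1 \<noteq> []" "chain r (r (hd L1)) (tl L1) (hd L1)" "distinct (L1 @ map r L1)"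
      "set (L1 @ map r L1) = ?B"
      using L1 by (simp_all add: alternating_def del: distinct_append set_append)
    have L1B: "set L1 \<subseteq> ?B" using L1'(4) by auto
    have set_h: "set (h y) = {y, r y} \<union> (if p y \<in> ?A then set (block_verts p (p y, lk (p y), en (p y))) else {})"
      if "y \<in> ?B" for y
      by (auto simp: h_def g_def r_def block_verts_simp)
    have mset_h: "mset (?L @ map p ?L) = mset (concat (map h L1))"
      unfolding h_def by (induction L1) auto
    have blkA: "set (block_verts p (t, lk t, en t)) \<subseteq> ?A" if "t \<in> T" for t
      using cover that by blast
    have "distinct (concat (map h L1))"
    proof (rule distinct_concat_map)
      show "distinct L1" using L1'(3) by simp
      fix y assume y: "y \<in> set L1"
      then have yB: "y \<in> ?B" "p y \<in> ?V" "p y \<noteq> y" "p (p y) = y" using L1B pV[of y] V by auto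
      show "distinct (h y)"
      proof (cases "p y \<in> ?A")
        case True
        note t = TB[OF yB(1) True]
        have m: "mset (h y) = mset ([y, p (en (p y))] @ block_verts p (p y, lk (p y), en (p y)))"
          using True yB(4) by (simp add: h_def g_def block_verts_simp)
        have "y \<noteq> p (en (p y))" using pairingD[OF r yB(1)] True by (auto simp: r_def)
        moreover have "y \<notin> ?A" "p (en (p y)) \<notin> ?A" using yB(1) BT(1)[of "en (p y)"] en[OF t] AB by blast+
        ultimately have "distinct ([y, p (en (p y))] @ block_verts p (p y, lk (p y), en (p y)))"
          using dist[OF t] blkA[OF t] by auto
        then show ?thesis using mset_eq_imp_distinct_iff[OF m] by blast
      next
        case False
        then show ?thesis using yB by (simp add: h_def g_def)
      qed
      fix z assume z: "z \<in> set L1" "y \<noteq> z"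
      then have zB: "z \<in> ?B" "p z \<in> ?V" "p (p z) = z" using L1B pV[of z] V by auto
      have "{y, r y} \<inter> {z, r z} = {}" using y z L1'(3) by (auto simp: distinct_map inj_on_def)
      moreover have "{y, r y} \<subseteq> ?B" "{z, r z} \<subseteq> ?B" using pairingD[OF r] yB(1) zB(1) by auto
      moreover have False if "p y \<in> ?A" "p z \<in> ?A" "x \<in> set (block_verts p (p y, lk (p y), en (p y)))"
        "x \<in> set (block_verts p (p z, lk (p z), en (p z)))" for x
      proof -
        have "p z = p y \<or> p z = en (p y)"
          using meet[OF TB[OF yB(1) that(1)] TB[OF zB(1) that(2)] that(3,4)] .
        then have "z = y \<or> z = r y" using that(1) yB(4) zB(3) by (metis r_def)
        with calculation(1) show False by blast
      qed
      moreover have "p y \<in> ?A \<Longrightarrow> set (block_verts p (p y, lk (p y), en (p y))) \<subseteq> ?A"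
        "p z \<in> ?A \<Longrightarrow> set (block_verts p (p z, lk (p z), en (p z))) \<subseteq> ?A"
        using blkA TB yB(1) zB(1) by blast+
      ultimately show "set (h y) \<inter> set (h z) = {}"
        unfolding set_h[OF yB(1)] set_h[OF zB(1)] using AB
        by (cases "p y \<in> ?A"; cases "p z \<in> ?A") (simp_all, blast+)
    qed
    then have "distinct (?L @ map p ?L)" using mset_eq_imp_distinct_iff[OF mset_h] by blast
    moreover have "set (concat (map h L1)) = ?V"
    proof
      show "set (concat (map h L1)) \<subseteq> ?V"
      proof
        fix x assume "x \<in> set (concat (map h L1))"
        then obtain y where y: "y \<in> set L1" "x \<in> set (h y)" by auto
        then have "y \<in> ?B" using L1B by blast
        with y(2) set_h[OF this] pairingD[OF r this] blkA[OF TB[OF this]] V show "x \<in> ?V"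
          by (auto split: if_splits)
      qed
      show "?V \<subseteq> set (concat (map h L1))"
      proof
        fix x assume "x \<in> ?V"
        then consider "x \<in> ?B" | "x \<in> ?A" using V by blast
        then show "x \<in> set (concat (map h L1))"
        proof cases
          case 1
          then have "x \<in> set (L1 @ map r L1)" using L1'(4) by blast
          then obtain y where "y \<in> set L1" "x \<in> {y, r y}" by auto
          then show ?thesis using set_h[of y] L1B by auto
        next
          case 2
          then obtain t where t: "t \<in> T" "x \<in> set (block_verts p (t, lk t, en t))" using cover by blast
          have "p t \<in> set (L1 @ map r L1)" using BT(1)[OF t(1)] L1'(4) by blast
          then obtain y where y: "y \<in> set L1" "p t = y \<or> p t = r y" by auto
          then have yB: "y \<in> ?B" "p (p y) = y" using L1B pV[of y] V by auto
          have "p y \<in> ?A \<and> x \<in> set (block_verts p (p y, lk (p y), en (p y)))"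
          proof (cases "p t = y")
            case True
            then show ?thesis using BT(2)[OF t(1)] t TA by auto
          next
            case False
            \<comment> \<open>The segment from \<open>t\<close> is then traversed backwards in the
              new cycle: \<open>t\<close> is the end of the segment starting at \<open>p y\<close>,
              and both orientations have the same vertices.\<close>
            then have pt: "p t = r y" using y(2) by blast
            show ?thesis
            proof (cases "p y \<in> ?A")
              case True
              note u = TB[OF yB(1) True]
              have "t = en (p y)" using pt True BT(2)[OF t(1)] BT(2)[of "en (p y)"] en[OF u]
                by (metis r_def)
              then show ?thesis using True sym[OF u] t(2) by simp
            next
              case False
              then have "p t = p y" using pt by (simp add: r_def)
              then have "t = y" using BT(2)[OF t(1)] yB(2) by metis
              then show ?thesis using t(1) TA yB(1) AB by blast
            qed
          qed
          then show ?thesis using set_h[OF yB(1)] y(1) by auto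
        qed
      qed
    qed
    then have "set (?L @ map p ?L) = ?V" using mset_eq_setD[OF mset_h] by blast
    moreover obtain y K where yK: "L1 = y # K" using L1'(1) by (cases L1) auto
    moreover have L: "?L = y # tl (g y) @ concat (map g K)" using g_Cons[of y] yK by simp
    moreover have "chain p (p y) (tl (g y) @ concat (map g K)) y"
      using L1'(2) L1B yK by (intro chain_g chain_concat) auto
    ultimately have "alternating ?V p ?L"
      unfolding alternating_def by (metis list.distinct(1) list.sel(1,3))
    then show ?thesis by blast
  qed
qed

lemma chain_path_edges:
  assumes "chain p t L e" "\<And>x. x \<in> set L \<Longrightarrow> {x, p x} \<in> cube_edges"
  shows "path_edges (t # concat (map (\<lambda>x. [x, p x]) L) @ [e]) \<subseteq> cube_edges \<and>
    (\<forall>x\<in>set L. {x, p x} \<in> path_edges (t # concat (map (\<lambda>x. [x, p x]) L) @ [e]))"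
  using assms by (induction L arbitrary: t) auto

theorem pairing_ham_cycle:
  assumes "finite D" "D \<noteq> {}" "pairing p (cube D a)" "\<And>x. x \<in> cube D a \<Longrightarrow> {x, p x} \<in> cube_edges"
  shows "ham_cycle (cube D a) {{x, p x} | x. x \<in> cube D a}"
proof -
  obtain L where L: "alternating (cube D a) p L" using pairing_extends[OF assms(1-3)] by blast
  then obtain y K where yK: "L = y # K" by (cases L) (auto simp: alternating_def)
  \<comment> \<open>Starting at \<open>p y\<close> and ending at \<open>y\<close> makes the first
    pair the closing edge of the cycle.\<close>
  define W where "W = p y # concat (map (\<lambda>x. [x, p x]) K) @ [y]"
  have m: "mset W = mset (L @ map p L)"
  proof -
    have "mset (concat (map (\<lambda>x. [x, p x]) K)) = mset (K @ map p K)" by (induction K) auto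
    then show ?thesis by (simp add: W_def yK)
  qed
  have KV: "set L \<subseteq> cube D a" using L by (auto simp: alternating_def)
  have pe: "path_edges W \<subseteq> cube_edges \<and> (\<forall>x\<in>set K. {x, p x} \<in> path_edges W)"
    unfolding W_def by (rule chain_path_edges) (use L KV yK assms(4) in \<open>auto simp: alternating_def\<close>)
  have ce: "closed_edges W = insert {y, p y} (path_edges W)"
    by (simp add: W_def closed_edges_def)
  have "{{x, p x} | x. x \<in> cube D a} \<subseteq> closed_edges W"
  proof
    fix e assume "e \<in> {{x, p x} | x. x \<in> cube D a}"
    then obtain x where x: "x \<in> cube D a" "e = {x, p x}" by blast
    then have "x \<in> set (L @ map p L)" using L by (simp add: alternating_def)
    then obtain z where z: "z \<in> set L" "x = z \<or> x = p z" by auto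
    then have "e = {z, p z}" using x(2) pairingD[OF assms(3), of z] KV by (auto simp: insert_commute)
    then show "e \<in> closed_edges W" using z(1) yK pe ce by auto
  qed
  moreover have "closed_edges W \<subseteq> cube_edges" using pe ce assms(4)[of y] KV yK by auto
  moreover have "distinct W" "set W = cube D a"
    using mset_eq_imp_distinct_iff[OF m] mset_eq_setD[OF m] L by (auto simp: alternating_def)
  moreover have "W \<noteq> []" by (simp add: W_def)
  ultimately show ?thesis unfolding ham_cycle_def by blast
qed

section \<open>Matchings in a cube\<close>

definition cube_matching :: "nat set \<Rightarrow> nat set \<Rightarrow> nat set set set \<Rightarrow> bool" where
  "cube_matching D a M \<longleftrightarrow> M \<subseteq> cube_edges \<and> (\<forall>e\<in>M. e \<subseteq> cube D a) \<and>
     (\<forall>e\<in>M. \<forall>f\<in>M. e \<inter> f \<noteq> {} \<longrightarrow> e = f)"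

definition dir_edges :: "nat \<Rightarrow> nat set set set" where
  "dir_edges d = {{x, flip d x} | x. True}"

lemma cube_matchingD:
  assumes "cube_matching D a M"
  shows "e \<in> M \<Longrightarrow> e \<in> cube_edges" "e \<in> M \<Longrightarrow> e \<subseteq> cube D a"
    "e \<in> M \<Longrightarrow> f \<in> M \<Longrightarrow> e \<inter> f \<noteq> {} \<Longrightarrow> e = f"
  using assms by (auto simp: cube_matching_def)

lemma cube_matching_unique:
  "cube_matching D a M \<Longrightarrow> e \<in> M \<Longrightarrow> f \<in> M \<Longrightarrow> x \<in> e \<Longrightarrow> x \<in> f \<Longrightarrow> e = f"
  by (rule cube_matchingD(3)) auto

lemma cube_matching_subset: "cube_matching D a M \<Longrightarrow> N \<subseteq> M \<Longrightarrow> cube_matching D a N"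
  unfolding cube_matching_def by (meson subsetD subset_trans)

lemma cube_matching_restrict:
  "cube_matching D a M \<Longrightarrow> cube_matching D' a' {e \<in> M. e \<subseteq> cube D' a'}"
  by (simp add: cube_matching_def subset_iff)

lemma cube_matching_insert:
  assumes "cube_matching D a M" "x \<in> cube D a" "i \<in> D" "x \<notin> \<Union>M" "flip i x \<notin> \<Union>M"
  shows "cube_matching D a (insert {x, flip i x} M)"
  using assms by (auto simp: cube_matching_def)

lemma finite_cube_matching: "cube_matching D a M \<Longrightarrow> finite D \<Longrightarrow> finite M"
  by (rule finite_subset[of _ "Pow (cube D a)"]) (auto simp: cube_matching_def finite_cube)

lemma cube_edgeE:
  assumes "e \<in> cube_edges"
  obtains x i where "e = {x, flip i x}"
  using assms by (auto simp: cube_edges_def)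

lemma cube_edgeE':
  assumes "e \<in> cube_edges" "x \<in> e"
  obtains i where "e = {x, flip i x}"
proof -
  obtain y i where e: "e = {y, flip i y}" using cube_edgeE[OF assms(1)] .
  show thesis
  proof (cases "x = y")
    case True
    then show ?thesis using e that by blast
  next
    case False
    then have "x = flip i y" using e assms(2) by blast
    then have "e = {x, flip i x}" using e by (simp add: insert_commute)
    then show ?thesis by (rule that)
  qed
qed

lemma card_Union_matching:
  assumes "cube_matching D a M" "finite D"
  shows "card (\<Union>M) = 2 * card M"
proof -
  have two: "card e = 2" if e: "e \<in> M" for e
  proof -
    obtain x i where "e = {x, flip i x}" using cube_edgeE[OF cube_matchingD(1)[OF assms(1) e]] .
    then show ?thesis by simp
  qed
  have "card (\<Union>M) = sum card M"
  proof (rule card_Union_disjoint)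
    show "pairwise disjnt M"
      using cube_matchingD(3)[OF assms(1)] by (auto simp: pairwise_def disjnt_def)
    show "finite e" if "e \<in> M" for e using two[OF that] by (simp add: card_ge_0_finite)
  qed
  then show ?thesis using two by simp
qed

text \<open>Bookkeeping for both induction steps. Crossing edges are written from their end in the
  half of \<open>a\<close>, so that both halves can be addressed through vertices of that
  half.\<close>

lemma matching_split:
  assumes M: "cube_matching D a M" and d: "d \<in> D" and fin: "finite D"
    and M0_def: "M0 = {e \<in> M. e \<subseteq> cube (D - {d}) a}"
    and M1_def: "M1 = {e \<in> M. e \<subseteq> cube (D - {d}) (flip d a)}"
  shows "M = M0 \<union> M1 \<union> (M \<inter> dir_edges d)"
    "card M = card M0 + card M1 + card (M \<inter> dir_edges d)"
    "\<And>e. e \<in> M \<Longrightarrow> e \<in> dir_edges d \<Longrightarrow> \<exists>w\<in>cube (D - {d}) a. e = {w, flip d w}"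
    "\<And>w. w \<in> cube (D - {d}) a \<Longrightarrow> {w, flip d w} \<in> M \<Longrightarrow> w \<notin> \<Union>M0 \<and> w \<notin> \<Union>M1 \<and> flip d w \<notin> \<Union>M0 \<and> flip d w \<notin> \<Union>M1"
    "cube_matching (D - {d}) a M0" "cube_matching (D - {d}) (flip d a) M1"
proof -
  let ?A = "cube (D - {d}) a" and ?B = "cube (D - {d}) (flip d a)"
  have AB: "?A \<inter> ?B = {}" using cube_disjoint[OF d] .
  show dirE: "\<exists>w\<in>?A. e = {w, flip d w}" if e: "e \<in> M" "e \<in> dir_edges d" for e
  proof -
    obtain x where x: "e = {x, flip d x}" using e by (auto simp: dir_edges_def)
    have "x \<in> cube D a" using cube_matchingD(2)[OF M e(1)] x by auto
    then consider "x \<in> ?A" | "x \<in> ?B" using cube_split[OF d] by blast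
    then show ?thesis
    proof cases
      case 2
      then have "flip d x \<in> ?A" using flip_in_cube_flip[of d x "D - {d}" "flip d a"] by simp
      moreover have "e = {flip d x, flip d (flip d x)}" using x by (simp add: insert_commute)
      ultimately show ?thesis by blast
    qed (use x in blast)
  qed
  have sub: "e \<subseteq> ?A \<or> e \<subseteq> ?B \<or> e \<in> dir_edges d" if "e \<in> M" for e
    using cube_edge_split[OF cube_matchingD(1)[OF M that] cube_matchingD(2)[OF M that] d] by (auto simp: dir_edges_def)
  then show eq: "M = M0 \<union> M1 \<union> (M \<inter> dir_edges d)" by (auto simp: M0_def M1_def)
  have ne: "e \<noteq> {}" if "e \<in> M" for e using cube_edgeE[OF cube_matchingD(1)[OF M that]] by blast
  have not_sub: "\<not> e \<subseteq> ?A \<and> \<not> e \<subseteq> ?B" if e: "e \<in> M" "e \<in> dir_edges d" for e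
  proof -
    obtain w where w: "w \<in> ?A" "e = {w, flip d w}" using dirE[OF e] by blast
    have "flip d w \<in> ?B" using w(1) by simp
    then show ?thesis using w AB by blast
  qed
  have "M0 \<inter> M1 = {}" using ne AB by (fastforce simp: M0_def M1_def)
  moreover have "(M0 \<union> M1) \<inter> (M \<inter> dir_edges d) = {}" using not_sub by (auto simp: M0_def M1_def)
  moreover have "finite M" using finite_cube_matching[OF M fin] .
  moreover have "finite M0" "finite M1" using \<open>finite M\<close> by (simp_all add: M0_def M1_def)
  ultimately show "card M = card M0 + card M1 + card (M \<inter> dir_edges d)"
    by (subst eq) (simp add: card_Un_disjoint)
  show "cube_matching (D - {d}) a M0" "cube_matching (D - {d}) (flip d a) M1"
    using cube_matching_restrict[OF M] by (simp_all add: M0_def M1_def)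
  show "w \<notin> \<Union>M0 \<and> w \<notin> \<Union>M1 \<and> flip d w \<notin> \<Union>M0 \<and> flip d w \<notin> \<Union>M1"
    if w: "w \<in> ?A" "{w, flip d w} \<in> M" for w
  proof -
    have "{w, flip d w} \<in> dir_edges d" by (auto simp: dir_edges_def)
    note ns = not_sub[OF w(2) this]
    have "w \<notin> e \<and> flip d w \<notin> e" if "e \<in> M0 \<union> M1" for e
    proof (rule ccontr)
      assume "\<not> ?thesis"
      moreover have e: "e \<in> M" "e \<subseteq> ?A \<or> e \<subseteq> ?B" using that by (auto simp: M0_def M1_def)
      ultimately have "e = {w, flip d w}" using cube_matching_unique[OF M e(1) w(2)] by auto
      then show False using ns e(2) by blast
    qed
    then show ?thesis by blast
  qed
qed

text \<open>Pigeonhole: edge sets of different directions are disjoint, so two edges in each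
  direction of \<open>S\<close> would need \<open>2 * card S\<close> edges. The set \<open>S\<close>
  is a parameter because the step for paths must avoid the direction joining the ends.\<close>

lemma sparse_direction:
  assumes M: "cube_matching D a M" "finite D" and S: "S \<subseteq> D" "card M < 2 * card S"
  obtains d where "d \<in> S" "card (M \<inter> dir_edges d) \<le> 1"
proof -
  have "\<exists>d\<in>S. card (M \<inter> dir_edges d) \<le> 1"
  proof (rule ccontr)
    assume "\<not> ?thesis"
    then have ge: "\<And>d. d \<in> S \<Longrightarrow> 2 \<le> card (M \<inter> dir_edges d)" by force
    have finM: "finite M" using finite_cube_matching[OF M] .
    have finS: "finite S" using S(1) M(2) finite_subset by blast
    have "2 * card S \<le> (\<Sum>d\<in>S. card (M \<inter> dir_edges d))"
      using sum_mono[of S "\<lambda>_. 2" "\<lambda>d. card (M \<inter> dir_edges d)"] ge by simp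
    also have "\<dots> = card (\<Union>d\<in>S. M \<inter> dir_edges d)"
    proof (rule card_UN_disjoint[symmetric])
      show "\<forall>i\<in>S. \<forall>j\<in>S. i \<noteq> j \<longrightarrow> (M \<inter> dir_edges i) \<inter> (M \<inter> dir_edges j) = {}"
        using cube_edge_dir_eq by (force simp: dir_edges_def)
    qed (use finS finM in auto)
    also have "\<dots> \<le> card M" using finM by (intro card_mono) auto
    finally show False using S(2) by simp
  qed
  then show thesis using that by blast
qed

section \<open>Matchings that are perfect or extend to perfect ones\<close>

definition mate :: "nat set set set \<Rightarrow> nat set \<Rightarrow> nat set" where
  "mate M x = (THE y. {x, y} \<in> M)"

lemma mate_eq:
  assumes "cube_matching D a M" "{x, y} \<in> M"
  shows "mate M x = y"
  unfolding mate_def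
proof (rule the_equality)
  fix z assume "{x, z} \<in> M"
  then have "{x, z} = {x, y}" using cube_matching_unique[OF assms(1) _ assms(2)] by blast
  then show "z = y" by (metis doubleton_eq_iff)
qed fact

lemma mate:
  assumes M: "cube_matching D a M" and x: "x \<in> \<Union>M"
  shows "{x, mate M x} \<in> M" "\<exists>i. mate M x = flip i x" "mate M x \<noteq> x" "mate M (mate M x) = x" "mate M x \<in> \<Union>M"
proof -
  obtain e where e: "e \<in> M" "x \<in> e" using x by blast
  obtain i where i: "e = {x, flip i x}" using cube_edgeE'[OF cube_matchingD(1)[OF M e(1)] e(2)] .
  then have m: "mate M x = flip i x" using mate_eq[OF M] e by blast
  then show "{x, mate M x} \<in> M" "\<exists>i. mate M x = flip i x" "mate M x \<noteq> x" using i e by auto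
  show "mate M x \<in> \<Union>M" using m i e by blast
  show "mate M (mate M x) = x"
    by (rule mate_eq[OF M]) (use m i e in \<open>simp add: insert_commute\<close>)
qed

lemma perfect_matching_ham_cycle:
  assumes "finite D" "D \<noteq> {}" "cube_matching D a M" "cube D a \<subseteq> \<Union>M"
  shows "ham_cycle (cube D a) M"
proof -
  note mt = mate[OF assms(3)]
  have sub: "\<Union>M \<subseteq> cube D a" using cube_matchingD(2)[OF assms(3)] by blast
  have "pairing (mate M) (cube D a)"
    using mt sub assms(4) unfolding pairing_def by (meson subsetD)
  moreover have "{x, mate M x} \<in> cube_edges" if "x \<in> cube D a" for x
    using mt(1)[of x] that assms(4) cube_matchingD(1)[OF assms(3)] by blast
  ultimately have "ham_cycle (cube D a) {{x, mate M x} | x. x \<in> cube D a}"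
    using pairing_ham_cycle assms(1,2) by blast
  moreover have "M \<subseteq> {{x, mate M x} | x. x \<in> cube D a}"
  proof
    fix e assume e: "e \<in> M"
    obtain x i where x: "e = {x, flip i x}" using cube_edgeE[OF cube_matchingD(1)[OF assms(3) e]] .
    then have "e = {x, mate M x}" using mate_eq[OF assms(3)] e by blast
    moreover have "x \<in> cube D a" using sub e x by blast
    ultimately show "e \<in> {{x, mate M x} | x. x \<in> cube D a}" by blast
  qed
  ultimately show ?thesis by (rule ham_cycle_mono)
qed

text \<open>The part of \<open>M\<close> inside the half is copied to the other half, and each
  vertex still uncovered is matched along \<open>d\<close>. The result is a perfect matching by cube
  edges. It contains the edges of \<open>M\<close> in direction \<open>d\<close>, because their ends
  are uncovered by the rest of \<open>M\<close>.\<close>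

lemma facet_matching_ham_cycle:
  assumes D: "finite D" and d: "d \<in> D" and M: "cube_matching D a M"
    and facet: "\<And>e. e \<in> M \<Longrightarrow> e \<subseteq> cube (D - {d}) a \<or> e \<in> dir_edges d"
  shows "ham_cycle (cube D a) M"
proof -
  let ?A = "cube (D - {d}) a" and ?B = "cube (D - {d}) (flip d a)"
  define M0 where "M0 = {e \<in> M. e \<subseteq> ?A}"
  have M0: "cube_matching (D - {d}) a M0" unfolding M0_def by (rule cube_matching_restrict[OF M])
  note mt = mate[OF M0]
  have AB: "?A \<inter> ?B = {}" and V: "cube D a = ?A \<union> ?B"
    using cube_disjoint[OF d] cube_split[OF d] by auto
  have UA: "\<Union>M0 \<subseteq> ?A" by (auto simp: M0_def)
  have fl: "flip d x \<notin> \<Union>M0" if "x \<in> \<Union>M0" for x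
  proof -
    have "flip d x \<in> ?B" using that UA by auto
    then show ?thesis using UA AB by blast
  qed
  define p where "p x = (if x \<in> \<Union>M0 then mate M0 x else if flip d x \<in> \<Union>M0
    then flip d (mate M0 (flip d x)) else flip d x)" for x
  have p: "p x \<in> cube D a \<and> p x \<noteq> x \<and> p (p x) = x \<and> {x, p x} \<in> cube_edges" if x: "x \<in> cube D a" for x
  proof -
    consider "x \<in> \<Union>M0" | "x \<notin> \<Union>M0" "flip d x \<in> \<Union>M0" | "x \<notin> \<Union>M0" "flip d x \<notin> \<Union>M0" by blast
    then show ?thesis
    proof cases
      case 1
      then have "{x, p x} \<in> cube_edges" using mt(1)[OF 1] cube_matchingD(1)[OF M0] by (simp add: p_def)
      moreover have "p x \<in> cube D a" using mt(5)[OF 1] UA V 1 by (auto simp: p_def)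
      ultimately show ?thesis using 1 mt(3-5)[OF 1] by (simp add: p_def del: Union_iff)
    next
      case 2
      let ?y = "flip d x"
      have px: "p x = flip d (mate M0 ?y)" using 2 by (simp add: p_def del: Union_iff)
      obtain i where i: "mate M0 ?y = flip i ?y" using mt(2)[OF 2(2)] by blast
      have "p x = flip i x" using px i by (simp add: flip_commute)
      then have "{x, p x} \<in> cube_edges" "p x \<noteq> x" by auto
      moreover have "p x \<in> cube D a" using px mt(5)[OF 2(2)] UA V d by auto
      moreover have "p x \<notin> \<Union>M0" using px fl mt(5)[OF 2(2)] by metis
      then have "p (p x) = x" using px mt(4,5)[OF 2(2)] by (simp add: p_def del: Union_iff)
      ultimately show ?thesis by blast
    next
      case 3
      then show ?thesis using x d by (simp add: p_def del: Union_iff)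
    qed
  qed
  have "ham_cycle (cube D a) {{x, p x} | x. x \<in> cube D a}"
    using p D d by (intro pairing_ham_cycle) (auto simp: pairing_def)
  moreover have "M \<subseteq> {{x, p x} | x. x \<in> cube D a}"
  proof
    fix e assume e: "e \<in> M"
    consider "e \<in> M0" | "e \<notin> M0" "e \<in> dir_edges d" using facet[OF e] e by (auto simp: M0_def)
    then have "\<exists>x. x \<in> e \<and> e = {x, p x}"
    proof cases
      case 1
      obtain x i where x: "e = {x, flip i x}" using cube_edgeE[OF cube_matchingD(1)[OF M e]] .
      have "mate M0 x = flip i x" using mate_eq[OF M0] x 1 by blast
      moreover have "x \<in> \<Union>M0" using x 1 by blast
      ultimately have "e = {x, p x}" using x by (simp add: p_def del: Union_iff)
      then show ?thesis using x by blast
    next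
      case 2
      then obtain x where x: "e = {x, flip d x}" by (auto simp: dir_edges_def)
      have "x \<notin> \<Union>M0" "flip d x \<notin> \<Union>M0"
        using cube_matching_unique[OF M e] 2(1) x unfolding M0_def by blast+
      then have "e = {x, p x}" using x by (simp add: p_def del: Union_iff)
      then show ?thesis using x by blast
    qed
    then show "e \<in> {{x, p x} | x. x \<in> cube D a}" using cube_matchingD(2)[OF M e] by blast
  qed
  ultimately show ?thesis by (rule ham_cycle_mono)
qed

text \<open>The path around the square uses all of its edges except
  \<open>{s, flip i s}\<close>.\<close>

lemma square_ham_path:
  assumes "card D = 2" "i \<in> D" "F \<subseteq> cube_edges" "\<And>e. e \<in> F \<Longrightarrow> e \<subseteq> cube D s" "{s, flip i s} \<notin> F"
  shows "ham_path (cube D s) F s (flip i s)"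
proof -
  obtain j where D: "D = {i, j}" "i \<noteq> j" using assms(1,2) by (auto simp: card_2_iff)
  let ?xs = "[s, flip j s, flip i (flip j s), flip i s]"
  have "cube D s = cube {i} s \<union> cube {i} (flip j s)"
    using cube_split[of j D s] D by (simp add: insert_commute insert_Diff_if)
  then have V: "cube D s = set ?xs" by (auto simp: cube_singleton)
  have ne: "flip i (flip j s) \<noteq> s" using D(2) by (metis flip_dir_eq flip_flip)
  have pe: "path_edges ?xs = {{s, flip j s}, {flip j s, flip i (flip j s)}, {flip i (flip j s), flip i s}}"
    by simp
  have "F \<subseteq> path_edges ?xs"
  proof
    fix e assume e: "e \<in> F"
    have "e \<in> cube_edges" using e assms(3) by blast
    then obtain x k where x: "e = {x, flip k x}" by (rule cube_edgeE)
    have xs: "x \<in> set ?xs" "flip k x \<in> cube D s" using assms(4)[OF e] V x by auto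
    then have "k \<in> D" using flip_in_cubeD[of k x D s] V by simp
    then have "k = i \<or> k = j" using D by auto
    moreover have "x = s \<or> x = flip j s \<or> x = flip i (flip j s) \<or> x = flip i s" using xs(1) by simp
    moreover have "{x, flip k x} \<noteq> {s, flip i s}" using e assms(5) unfolding x by metis
    ultimately show "e \<in> path_edges ?xs"
      unfolding pe x by (elim disjE) (simp_all add: insert_commute flip_commute[of j i])
  qed
  moreover have "path_edges ?xs \<subseteq> cube_edges"
    unfolding pe using flip_edge(1)[of "flip j s" i] flip_edge(2)[of j "flip i s"]
    by (simp add: flip_commute[of i j])
  moreover have "distinct ?xs" using ne D(2) by (auto simp: flip_commute[of i j])
  ultimately show ?thesis using V by (intro ham_pathI[of ?xs]) auto
qed

section \<open>The induction step for cycles\<close>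

definition cyclic_ext :: "nat set \<Rightarrow> bool" where
  "cyclic_ext D \<longleftrightarrow> (\<forall>a M. finite a \<longrightarrow> cube_matching D a M \<longrightarrow> card M \<le> 2 * card D - 1 \<longrightarrow>
     ham_cycle (cube D a) M)"

text \<open>The bound is what the smaller half of a matching of \<open>cyclic_ext\<close> size
  satisfies one dimension higher. That \<open>a\<close> is uncovered keeps the edge
  \<open>{a, flip i a}\<close> out of \<open>M\<close>; the other end may be covered.\<close>

definition path_ext :: "nat set \<Rightarrow> bool" where
  "path_ext D \<longleftrightarrow> (\<forall>a i M. finite a \<longrightarrow> i \<in> D \<longrightarrow> cube_matching D a M \<longrightarrow> card M \<le> card D \<longrightarrow>
     a \<notin> \<Union>M \<longrightarrow> ham_path (cube D a) M a (flip i a))"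

lemma cyclic_extD:
  "cyclic_ext D \<Longrightarrow> finite a \<Longrightarrow> cube_matching D a M \<Longrightarrow> card M \<le> 2 * card D - 1 \<Longrightarrow> ham_cycle (cube D a) M"
  by (simp add: cyclic_ext_def)

lemma path_extD:
  "path_ext D \<Longrightarrow> finite a \<Longrightarrow> i \<in> D \<Longrightarrow> cube_matching D a M \<Longrightarrow> card M \<le> card D \<Longrightarrow> a \<notin> \<Union>M \<Longrightarrow>
    ham_path (cube D a) M a (flip i a)"
  by (simp add: path_ext_def)

lemma cube_matching_cong: "b \<in> cube D a \<Longrightarrow> cube_matching D b M \<longleftrightarrow> cube_matching D a M"
  by (simp add: cube_matching_def cube_eq)

lemma path_ext_edge:
  assumes "path_ext D" "finite D" "finite a" "cube_matching D a M" "card M \<le> card D"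
    "x \<in> cube D a" "y \<in> cube D a" "{x, y} \<in> cube_edges" "x \<notin> \<Union>M"
  shows "ham_path (cube D a) M x y"
proof -
  obtain i where i: "y = flip i x" using assms(8) cube_edge_iff by blast
  then have "i \<in> D" using flip_in_cubeD[of i x D a] assms(6,7) by simp
  have "ham_path (cube D x) M x (flip i x)"
    by (rule path_extD[OF assms(1)])
      (use assms \<open>i \<in> D\<close> cube_matching_cong[OF assms(6)] finite_mem_cube[OF assms(6)] in auto)
  then show ?thesis using i cube_eq[OF assms(6)] by simp
qed

lemma laceable:
  assumes "finite D" "D \<noteq> {}" "finite a" "s \<in> cube D a" "t \<in> cube D a" "even (card s) \<noteq> even (card t)"
    and "F \<subseteq> {f}" "F \<subseteq> cube_edges" "\<And>e. e \<in> F \<Longrightarrow> e \<subseteq> cube D a" "{s, t} \<notin> F"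
  shows "ham_path (cube D a) F s t"
proof -
  have "ham_path (cube D s) F s t"
    by (rule cube_laceable[of D s t F f])
      (use assms cube_eq[OF assms(4)] finite_mem_cube[OF assms(4)] in auto)
  then show ?thesis using cube_eq[OF assms(4)] by simp
qed

lemma flip_cube_edge: "{x, y} \<in> cube_edges \<Longrightarrow> {flip d x, flip d y} \<in> cube_edges"
  by (auto simp: cube_edge_iff) (metis flip_commute)

lemma flip_mem_other: "x \<in> cube D' a \<Longrightarrow> flip d x \<in> cube D' (flip d a)"
  by simp

lemma cycle_through_halves:
  assumes "d \<in> D" "ham_path (cube (D - {d}) a) F s t"
    "ham_path (cube (D - {d}) (flip d a)) G (flip d s) (flip d t)"
    "M \<subseteq> F \<union> G \<union> {{s, flip d s}, {t, flip d t}}"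
  shows "ham_cycle (cube D a) M"
  using ham_cycle_join[OF assms(2,3) cube_disjoint[OF assms(1)] flip_edge(1) flip_edge(1)] assms(4)
  unfolding cube_split[OF assms(1), of a] by (auto elim: ham_cycle_mono)

lemma path_through_halves:
  assumes "d \<in> D" "ps \<noteq> []" "qs \<noteq> []" "distinct (ps @ qs)" "set (ps @ qs) = cube (D - {d}) a"
    "path_edges ps \<union> path_edges qs \<subseteq> cube_edges"
    "ham_path (cube (D - {d}) (flip d a)) G (flip d (last ps)) (flip d (hd qs))"
    "M \<subseteq> path_edges ps \<union> path_edges qs \<union> G \<union> {{last ps, flip d (last ps)}, {hd qs, flip d (hd qs)}}"
  shows "ham_path (cube D a) M (hd ps) (last qs)"
proof -
  have "ham_path (cube D a) ({{last ps, flip d (last ps)}, {hd qs, flip d (hd qs)}} \<union>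
      (path_edges ps \<union> path_edges qs) \<union> G) (hd ps) (last qs)"
    unfolding cube_split[OF assms(1), of a]
    by (rule ham_path_splice[OF assms(2-6) cube_disjoint[OF assms(1)] assms(7)]) simp
  then show ?thesis by (rule ham_path_mono) (use assms(8) in blast)
qed

lemma cyclic_ext_step_oriented:
  assumes D: "finite D" "d \<in> D" "card D \<ge> 3" and a: "finite a"
    and IH: "cyclic_ext (D - {d})" "path_ext (D - {d})"
    and M: "cube_matching D a M" "card M \<le> 2 * card D - 1" "card (M \<inter> dir_edges d) \<le> 1"
    and M0_def: "M0 = {e \<in> M. e \<subseteq> cube (D - {d}) a}"
    and M1_def: "M1 = {e \<in> M. e \<subseteq> cube (D - {d}) (flip d a)}"
    and le: "card M1 \<le> card M0"
  shows "ham_cycle (cube D a) M"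
proof -
  let ?D = "D - {d}" and ?Md = "M \<inter> dir_edges d"
  let ?A = "cube ?D a" and ?B = "cube ?D (flip d a)"
  note split = matching_split[OF M(1) D(2) D(1) M0_def M1_def]
  have cD: "card ?D = card D - 1" using D by simp
  have "?D \<noteq> {}"
  proof
    assume "?D = {}"
    then have "card ?D = 0" by (simp only: card.empty)
    then show False using cD D(3) by linarith
  qed
  with cD D(1) have finD: "finite ?D" "card ?D = card D - 1" "?D \<noteq> {}" by simp_all
  have fin: "finite M" "finite M0" "finite M1" "finite ?A" "finite ?B"
    using finite_cube_matching[OF M(1) D(1)] finite_cube[OF finD(1)] by (auto simp: M0_def M1_def)
  have cA: "card ?A = 2 ^ card ?D" "card ?B = 2 ^ card ?D" using card_cube[OF finD(1)] by auto
  have "(2::nat) ^ 2 \<le> 2 ^ card ?D" using finD D by (intro power_increasing) auto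
  then have cA4: "card ?A \<ge> 4" using cA by simp
  then have cA2: "card ?A > 2" by simp
  have unique0: "\<And>e f. e \<in> M0 \<Longrightarrow> f \<in> M0 \<Longrightarrow> e \<inter> f \<noteq> {} \<Longrightarrow> e = f"
    using cube_matchingD(3)[OF split(5)] by blast
  have finA: "finite x" if "x \<in> ?A" for x using finite_mem_cube[OF that finD(1) a] .
  have par: "even (card s) \<noteq> even (card t)" if "ham_path ?A F s t" for F s t
    using ham_path_parity[OF that finA] cA(1) finD(2) D(3) by simp
  have lace: "ham_path ?B F (flip d s) (flip d t)"
    if "ham_path ?A G s t" "F \<subseteq> {f}" "F \<subseteq> M1" "{flip d s, flip d t} \<notin> F" for F G f s t
  proof (rule laceable[OF finD(1,3) _ _ _ _ that(2)])
    have st: "s \<in> ?A" "t \<in> ?A" using ham_path_ends[OF that(1)] by auto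
    then show "even (card (flip d s)) \<noteq> even (card (flip d t))"
      using par[OF that(1)] by (simp add: even_card_flip finA)
    show "F \<subseteq> cube_edges" using that(3) cube_matchingD(1)[OF split(6)] by blast
    show "e \<subseteq> ?B" if "e \<in> F" for e using that \<open>F \<subseteq> M1\<close> cube_matchingD(2)[OF split(6)] by blast
  qed (use a that ham_path_ends[OF that(1)] in auto)
  show ?thesis
  proof (cases "card M0 \<le> 2 * card D - 3")
    case True
    \<comment> \<open>Twice the smaller part is at most \<open>2 * card D - 1\<close>; rounding down
      gives \<open>card D - 1\<close>.\<close>
    have c1: "card M1 \<le> card ?D" using le split(2) M(2) finD(2) by linarith
    have C0: "ham_cycle ?A M0"
      using cyclic_extD[OF IH(1) a split(5)] True finD(2) D(3) by simp
    have key: ?thesis if w: "w \<in> ?A" "flip d w \<notin> \<Union>M1" "?Md \<subseteq> {{w, flip d w}}" for w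
    proof -
      obtain y where y: "{w, y} \<in> cube_edges" "ham_path ?A M0 w y"
        using ham_cycle_open[OF C0 unique0 w(1) cA2] by blast
      have "y \<in> ?A" using ham_path_ends[OF y(2)] by blast
      then have "ham_path ?B M1 (flip d w) (flip d y)"
        using path_ext_edge[OF IH(2) finD(1) _ split(6) c1 flip_mem_other[OF w(1)] flip_mem_other flip_cube_edge[OF y(1)] w(2)] a
        by simp
      moreover have "M \<subseteq> M0 \<union> M1 \<union> {{w, flip d w}, {y, flip d y}}"
        by (subst split(1)) (use w(3) in blast)
      ultimately show ?thesis by (rule cycle_through_halves[OF D(2) y(2)])
    qed
    show ?thesis
    proof (cases "?Md = {}")
      case False
      then obtain e where e: "e \<in> M" "e \<in> dir_edges d" by blast
      then obtain w where w: "w \<in> ?A" "e = {w, flip d w}" using split(3) by blast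
      have "?Md \<subseteq> {e}" using M(3) e fin(1) card_le_Suc0_iff_eq[of ?Md] by auto
      then show ?thesis using key[OF w(1)] split(4)[OF w(1)] e(1) w(2) by blast
    next
      case Md: True
      show ?thesis
      proof (cases "\<exists>w\<in>?A. flip d w \<notin> \<Union>M1")
        case True
        then show ?thesis using key Md by blast
      next
        case False
        \<comment> \<open>There is no free vertex at which to start a path in the upper half. Then
          \<open>M1\<close> covers that half, and \<open>M0\<close>, being at least as large, covers
          the other, so \<open>M\<close> is a perfect matching.\<close>
        have "?B \<subseteq> \<Union>M1"
        proof
          fix x assume "x \<in> ?B"
          then have "flip d x \<in> ?A" using flip_in_cube_flip[of d x ?D "flip d a"] by simp
          then show "x \<in> \<Union>M1" using False by force
        qed
        moreover have "\<Union>M0 = ?A"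
        proof (rule card_subset_eq[OF fin(4)])
          show "\<Union>M0 \<subseteq> ?A" by (auto simp: M0_def)
          have "\<Union>M1 \<subseteq> ?B" by (auto simp: M1_def)
          then have "card ?B \<le> card (\<Union>M1)"
            using \<open>?B \<subseteq> \<Union>M1\<close> by simp
          then have "card ?A \<le> card (\<Union>M0)"
            using card_Union_matching[OF split(5) finD(1)] card_Union_matching[OF split(6) finD(1)] le cA
            by simp
          then show "card (\<Union>M0) = card ?A" using card_mono[OF fin(4) \<open>\<Union>M0 \<subseteq> ?A\<close>] by simp
        qed
        ultimately have "cube D a \<subseteq> \<Union>M"
          using cube_split[OF D(2), of a] split(1) by blast
        then show ?thesis using perfect_matching_ham_cycle[OF D(1) _ M(1)] D(2) by blast
      qed
    qed
  next
    case big: False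
    show ?thesis
    proof (cases "M1 = {}")
      case True
      then show ?thesis using facet_matching_ham_cycle[OF D(1,2) M(1)] split(1) by (auto simp: M0_def)
    next
      case False
      then have c1: "card M1 \<ge> 1" using fin(3) by (simp add: Suc_leI card_gt_0_iff)
      \<comment> \<open>The lower bounds \<open>2 * card D - 2\<close> for \<open>M0\<close> and 1
        for \<open>M1\<close> already add up to the maximal size of \<open>M\<close>, so both are
        attained and nothing crosses.\<close>
      have cs: "card M1 = 1" "card ?Md = 0" "card M0 = 2 * card D - 2"
        using split(2) M(2) big c1 D(3) by linarith+
      obtain f where f: "M1 = {f}" using cs(1) by (auto simp: card_1_singleton_iff)
      have Md: "?Md = {}" using cs(2) fin(1) by simp
      have MM: "M \<subseteq> M0 \<union> {f}" using split(1) Md f by blast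
      have "M0 \<noteq> {}" using cs(3) D(3) by auto
      then obtain e where e: "e \<in> M0" by blast
      obtain x j where x: "e = {x, flip j x}" using cube_edgeE[OF cube_matchingD(1)[OF split(5) e]] .
      have "ham_cycle ?A (M0 - {e})"
      proof (rule cyclic_extD[OF IH(1) a])
        show "cube_matching ?D a (M0 - {e})" by (rule cube_matching_subset[OF split(5)]) blast
        show "card (M0 - {e}) \<le> 2 * card ?D - 1" using cs(3) e fin(2) finD(2) D(3) by simp
      qed
      moreover have "x \<in> ?A" "flip j x \<in> ?A" using cube_matchingD(2)[OF split(5) e] x by auto
      moreover have "x \<notin> \<Union>(M0 - {e})" "flip j x \<notin> \<Union>(M0 - {e})"
        using cube_matching_unique[OF split(5) e] x by blast+
      ultimately obtain s t where "ham_path ?A (insert {x, flip j x} (M0 - {e})) s t"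
        using ham_cycle_chord[of ?A "M0 - {e}" x "flip j x"] flip_edge(1) flip_neq(2) by metis
      then have st: "ham_path ?A M0 s t" using x e by (simp add: insert_absorb)
      \<comment> \<open>The path in the other half must contain \<open>f\<close>, so its ends must
        not be those of \<open>f\<close>. If they are, \<open>s\<close> and \<open>t\<close> are
        adjacent, the path closes to a cycle through \<open>M0\<close>, and this cycle is reopened
        at a third vertex.\<close>
      obtain u v where uv: "ham_path ?A M0 u v" "{flip d u, flip d v} \<noteq> f"
      proof (cases "{flip d s, flip d t} = f")
        case False
        then show ?thesis using st that by blast
      next
        case True
        have "f \<in> cube_edges" using cube_matchingD(1)[OF split(6)] f by blast
        then have "{flip d s, flip d t} \<in> cube_edges" using True by simp
        from flip_cube_edge[OF this, of d] have "{t, s} \<in> cube_edges" by (simp add: insert_commute)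
        from ham_path_close[OF st this] have C0: "ham_cycle ?A M0" by (rule ham_cycle_mono) blast
        have "\<not> ?A \<subseteq> {s, t}"
        proof
          assume "?A \<subseteq> {s, t}"
          then have "card ?A \<le> card {s, t}" by (intro card_mono) auto
          also have "\<dots> \<le> 2" by (simp add: card_insert_if)
          finally show False using cA4 by simp
        qed
        then obtain w where w: "w \<in> ?A" "w \<noteq> s" "w \<noteq> t" by blast
        obtain y where y: "ham_path ?A M0 w y"
          using ham_cycle_open[OF C0 unique0 w(1) cA2] by blast
        have "flip d w \<notin> f" using w True by (metis flip_eq_iff insertE singletonD)
        then have "{flip d w, flip d y} \<noteq> f" by blast
        then show ?thesis using that y by blast
      qed
      have "ham_path ?B {f} (flip d u) (flip d v)" by (rule lace[OF uv(1)]) (use f uv(2) in auto)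
      from cycle_through_halves[OF D(2) uv(1) this] MM show ?thesis by blast
    qed
  qed
qed

lemma cyclic_ext_step:
  assumes D: "finite D" "card D \<ge> 3"
    and IH: "\<And>d. d \<in> D \<Longrightarrow> cyclic_ext (D - {d}) \<and> path_ext (D - {d})"
  shows "cyclic_ext D"
  unfolding cyclic_ext_def
proof (intro allI impI)
  fix a M
  assume a: "finite a" and M: "cube_matching D a M" "card M \<le> 2 * card D - 1"
  have "card M < 2 * card D" using M(2) D(2) by linarith
  then obtain d where d: "d \<in> D" "card (M \<inter> dir_edges d) \<le> 1"
    using sparse_direction[OF M(1) D(1) subset_refl] by blast
  let ?N = "\<lambda>b. {e \<in> M. e \<subseteq> cube (D - {d}) b}"
  show "ham_cycle (cube D a) M"
  proof (cases "card (?N (flip d a)) \<le> card (?N a)")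
    case True
    then show ?thesis
      using cyclic_ext_step_oriented[OF D(1) d(1) D(2) a _ _ M d(2) refl refl] IH[OF d(1)] by blast
  next
    case False
    have ca: "flip d a \<in> cube D a" using d(1) by simp
    have "card {e \<in> M. e \<subseteq> cube (D - {d}) (flip d (flip d a))} \<le> card (?N (flip d a))"
      using False by simp
    then have "ham_cycle (cube D (flip d a)) M"
      using cyclic_ext_step_oriented[OF D(1) d(1) D(2) _ _ _ _ M(2) d(2) refl refl, of "flip d a"]
        IH[OF d(1)] a M(1) cube_matching_cong[OF ca] by simp
    then show ?thesis using cube_flip[OF d(1)] by simp
  qed
qed

section \<open>The induction step for paths\<close>

text \<open>The crossing edge leaves at most \<open>card D - 1\<close> edges for each half. The path
  of the half of \<open>a\<close> is cut just before the lower end \<open>w\<close> of the crossing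
  edge: a predecessor exists because \<open>a\<close> is uncovered, while \<open>w\<close> may be
  the last vertex. The cut edge is not in \<open>M\<close>, as \<open>w\<close> is already matched
  across, and for the same reason the detour starts at a vertex uncovered by
  \<open>M1\<close>.\<close>

lemma path_ext_halves_crossing:
  assumes D: "finite D" "d \<in> D" "i \<in> D - {d}" and a: "finite a" and IH: "path_ext (D - {d})"
    and M: "cube_matching D a M" "a \<notin> \<Union>M" "card M \<le> card D" "card (M \<inter> dir_edges d) = 1"
  shows "ham_path (cube D a) M a (flip i a)"
proof -
  let ?D = "D - {d}" and ?Md = "M \<inter> dir_edges d"
  let ?A = "cube ?D a" and ?B = "cube ?D (flip d a)"
  define M0 where "M0 = {e \<in> M. e \<subseteq> ?A}"
  define M1 where "M1 = {e \<in> M. e \<subseteq> ?B}"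
  note split = matching_split[OF M(1) D(2) D(1) M0_def M1_def]
  have cD: "card ?D = card D - 1" "finite ?D" using D by simp_all
  have c: "card M0 \<le> card ?D" "card M1 \<le> card ?D"
    using split(2) M(3,4) cD by linarith+
  obtain e where Md: "?Md = {e}" using M(4) by (auto simp: card_1_singleton_iff)
  then obtain w where w: "w \<in> ?A" "e = {w, flip d w}" using split(3)[of e] by blast
  have wM: "w \<notin> \<Union>M0" "flip d w \<notin> \<Union>M1" "{w, flip d w} \<in> M"
    using split(4)[OF w(1)] Md w(2) by blast+
  have "a \<notin> \<Union>M0" using M(2) by (auto simp: M0_def)
  from path_extD[OF IH a D(3) split(5) c(1) this]
  obtain xs where xs: "xs \<noteq> []" "hd xs = a" "last xs = flip i a" "distinct xs" "set xs = ?A"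
    "path_edges xs \<subseteq> cube_edges" "M0 \<subseteq> path_edges xs"
    unfolding ham_path_def by blast
  obtain ps qs where pq: "xs = ps @ w # qs" using split_list[of w xs] w(1) xs(5) by blast
  have "w \<noteq> a" using wM(3) M(2) by blast
  then have ps: "ps \<noteq> []" using pq xs(2) by auto
  let ?y = "last ps"
  have y: "?y \<in> ?A" "{?y, w} \<in> cube_edges"
    using xs(5,6) pq ps last_in_set[OF ps] by (auto simp: path_edges_append)
  have "ham_path ?B M1 (flip d w) (flip d ?y)"
    using path_ext_edge[OF IH cD(2) _ split(6) c(2) flip_mem_other[OF w(1)] flip_mem_other[OF y(1)] _ wM(2)]
      a flip_cube_edge[OF y(2), of d] by (simp add: insert_commute)
  from ham_path_rev[OF this] have B: "ham_path ?B M1 (flip d (last ps)) (flip d (hd (w # qs)))" by simp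
  have "{?y, w} \<notin> M0" using wM(1) by blast
  then have M0: "M0 \<subseteq> path_edges ps \<union> path_edges (w # qs)"
    using xs(7) pq ps by (auto simp: path_edges_append)
  have "ham_path (cube D a) M (hd ps) (last (w # qs))"
  proof (rule path_through_halves[OF D(2) ps _ _ _ _ B])
    show "path_edges ps \<union> path_edges (w # qs) \<subseteq> cube_edges"
      using xs(6) pq by (auto simp: path_edges_append)
    show "M \<subseteq> path_edges ps \<union> path_edges (w # qs) \<union> M1 \<union>
        {{last ps, flip d (last ps)}, {hd (w # qs), flip d (hd (w # qs))}}"
    proof -
      have "M \<subseteq> M0 \<union> M1 \<union> {{w, flip d w}}" using split(1) Md w(2) by blast
      then show ?thesis using M0 by (simp only: list.sel) blast
    qed
  qed (use xs pq in auto)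
  moreover have "hd ps = a" "last (w # qs) = flip i a" using xs pq ps by auto
  ultimately show ?thesis by simp
qed

text \<open>All of \<open>M\<close> in one half may be one edge more than the induction hypothesis
  admits. One edge \<open>e\<close> avoiding the end \<open>flip i a\<close> is dropped, which is
  possible since there are two edges, and is forced back by rearranging the path; the resulting gap
  is bridged by a path through the empty half.\<close>

lemma path_ext_facet:
  assumes D: "finite D" "d \<in> D" "i \<in> D - {d}" and a: "finite a" and IH: "path_ext (D - {d})"
    and M: "cube_matching D a M" "a \<notin> \<Union>M" "card M \<le> card D" "2 \<le> card M"
    and facet: "\<And>e. e \<in> M \<Longrightarrow> e \<subseteq> cube (D - {d}) a"
  shows "ham_path (cube D a) M a (flip i a)"
proof -
  let ?D = "D - {d}" and ?b = "flip i a"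
  let ?A = "cube ?D a" and ?B = "cube ?D (flip d a)"
  have cD: "card ?D = card D - 1" "finite ?D" "?D \<noteq> {}" using D by auto
  have finM: "finite M" using finite_cube_matching[OF M(1) D(1)] .
  obtain e where e: "e \<in> M" "?b \<notin> e"
  proof -
    have "\<not> (\<forall>e\<in>M. \<forall>f\<in>M. e = f)" using M(4) card_le_Suc0_iff_eq[OF finM] by simp
    then obtain e f where "e \<in> M" "f \<in> M" "e \<noteq> f" by blast
    then show ?thesis using that cube_matching_unique[OF M(1)] by metis
  qed
  let ?N = "M - {e}"
  have "ham_path ?A ?N a ?b"
  proof (rule path_extD[OF IH a D(3)])
    show "cube_matching ?D a ?N"
      using M(1) facet by (auto simp: cube_matching_def)
    show "card ?N \<le> card ?D" using e(1) finM M(3) cD(1) by simp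
  qed (use M(2) in blast)
  then obtain xs where xs: "xs \<noteq> []" "hd xs = a" "last xs = ?b" "distinct xs" "set xs = ?A"
    "path_edges xs \<subseteq> cube_edges" "?N \<subseteq> path_edges xs"
    unfolding ham_path_def by blast
  obtain x p1 p2 y p3 where x: "e = {x, y}" "x \<noteq> y" "xs = p1 @ x # p2 @ y # p3"
  proof -
    obtain u j where u: "e = {u, flip j u}" using cube_edgeE[OF cube_matchingD(1)[OF M(1) e(1)]] .
    have uA: "u \<in> set xs" "flip j u \<in> set xs" using facet[OF e(1)] u xs(5) by auto
    obtain r1 r2 where r: "xs = r1 @ u # r2" using split_list[OF uA(1)] by blast
    then consider "flip j u \<in> set r1" | "flip j u \<in> set r2" using uA(2) by auto
    then show ?thesis
    proof cases
      case 1
      then obtain s1 s2 where "r1 = s1 @ flip j u # s2" using split_list by fast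
      then show ?thesis using that[of "flip j u" u s1 s2 r2] u r by (simp add: insert_commute)
    next
      case 2
      then obtain s1 s2 where "r2 = s1 @ flip j u # s2" using split_list by fast
      then show ?thesis using that[of u "flip j u" r1 s1 s2] u r by simp
    qed
  qed
  have exy: "{x, y} \<in> cube_edges" using cube_matchingD(1)[OF M(1) e(1)] x(1) by simp
  have xy: "x \<noteq> a" "y \<noteq> ?b" using x(1) e M(2) by auto
  have p1: "p1 \<noteq> []" using xy(1) xs(2) x(3) by auto
  have p3: "p3 \<noteq> []"
  proof
    assume "p3 = []"
    then have "last xs = y" by (simp add: x(3))
    then show False using xy(2) xs(3) by metis
  qed
  \<comment> \<open>Reversing \<open>p2\<close> makes \<open>x\<close> and \<open>y\<close>
    consecutive. The edges lost, from \<open>x\<close> to \<open>p2\<close> and from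
    \<open>y\<close> to \<open>p3\<close>, meet \<open>e\<close> and so are not in the
    matching.\<close>
  let ?ps = "p1 @ [x, y] @ rev p2"
  let ?s = "last ?ps" and ?t = "hd p3"
  have pe: "path_edges ?ps \<union> path_edges p3 \<subseteq> cube_edges"
    using xs(6) exy unfolding x(3)
    by (auto simp: path_edges_append path_edges_Cons hd_rev insert_commute hd_append split: if_splits)
  have NP: "?N \<subseteq> path_edges ?ps \<union> path_edges p3"
  proof
    fix f assume f: "f \<in> ?N"
    then have "x \<notin> f" "y \<notin> f" using cube_matching_unique[OF M(1) e(1)] x(1) by blast+
    moreover have "f \<in> path_edges xs" using f xs(7) by blast
    ultimately show "f \<in> path_edges ?ps \<union> path_edges p3"
      unfolding x(3) by (auto simp: path_edges_append path_edges_Cons hd_append split: if_splits)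
  qed
  have st: "?s \<in> ?A" "?t \<in> ?A"
    using xs(5) x(3) p3 last_in_set[of ?ps] hd_in_set[OF p3] by auto
  have fin: "finite v" if "v \<in> ?A" for v using finite_mem_cube[OF that cD(2) a] .
  have par: "even (card u) \<noteq> even (card v)" if uv: "{u, v} \<in> cube_edges" "u \<in> ?A" for u v
  proof -
    obtain k where "v = flip k u" using uv(1) cube_edge_iff by blast
    then show ?thesis using even_card_flip[OF fin[OF uv(2)]] by simp
  qed
  have xyA: "x \<in> ?A" "y \<in> ?A" using xs(5) x(3) by auto
  have "{y, ?t} \<in> cube_edges" using xs(6) p3 unfolding x(3)
    by (auto simp: path_edges_append path_edges_Cons hd_append split: if_splits)
  then have "even (card y) \<noteq> even (card ?t)" using par xyA by blast
  \<comment> \<open>If \<open>p2\<close> is nonempty, the gap starts at a neighbour of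
    \<open>x\<close>, as \<open>y\<close> is; if it is empty, the gap starts at \<open>y\<close>
    itself. It ends at a neighbour of \<open>y\<close>, so its ends have opposite parity, as
    laceability requires.\<close>
  moreover have "even (card ?s) = even (card y)"
  proof (cases "p2 = []")
    case False
    then have s: "?s = hd p2" by (simp add: last_rev)
    have "{x, hd p2} \<in> cube_edges" using xs(6) False unfolding x(3)
      by (auto simp: path_edges_append path_edges_Cons hd_append split: if_splits)
    then show ?thesis using par[OF _ xyA(1)] exy s by metis
  qed simp
  ultimately have "even (card ?s) \<noteq> even (card ?t)" by simp
  then have B: "ham_path ?B {} (flip d ?s) (flip d ?t)"
    using cD st a fin by (intro laceable[where f = "{}"]) (simp_all add: even_card_flip)
  have "ham_path (cube D a) M (hd ?ps) (last p3)"
  proof (rule path_through_halves[OF D(2) _ p3 _ _ pe B])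
    have "e \<in> path_edges ?ps" by (simp add: x(1) path_edges_append path_edges_Cons)
    then have "M \<subseteq> path_edges ?ps \<union> path_edges p3" using NP by blast
    then show "M \<subseteq> path_edges ?ps \<union> path_edges p3 \<union> {} \<union> {{?s, flip d ?s}, {?t, flip d ?t}}" by blast
    show "set (?ps @ p3) = ?A" using xs(5) x(3) by auto
  qed (use xs(4) x(3) in auto)
  moreover have "hd ?ps = a" "last p3 = ?b" using xs(2,3) x(3) p1 p3 by auto
  ultimately show ?thesis by simp
qed

text \<open>The cycle statement applies in the half of \<open>M\<close>, since
  \<open>card D <= 2 * card D - 3\<close>. The cycle is opened at an edge outside \<open>M\<close>
  whose mirror image is not the edge joining the required ends; laceability gives a path through
  that image, which is then replaced by the detour. Choosing \<open>w\<close> different from both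
  ends ensures this.\<close>

lemma path_ext_opposite_facet:
  assumes D: "finite D" "d \<in> D" "i \<in> D - {d}" "card D \<ge> 3" and a: "finite a" and IH: "cyclic_ext (D - {d})"
    and M: "cube_matching D a M" "card M \<le> card D"
    and facet: "\<And>e. e \<in> M \<Longrightarrow> e \<subseteq> cube (D - {d}) (flip d a)"
  shows "ham_path (cube D a) M a (flip i a)"
proof -
  let ?D = "D - {d}" and ?b = "flip i a"
  let ?A = "cube ?D a" and ?B = "cube ?D (flip d a)"
  have cD: "card ?D = card D - 1" "finite ?D" "?D \<noteq> {}" using D by auto
  have MB: "cube_matching ?D (flip d a) M" using M(1) facet by (auto simp: cube_matching_def)
  have "(2::nat) ^ 2 \<le> 2 ^ card ?D" using cD D by (intro power_increasing) auto
  then have cB: "card ?B > 2" "card ?A > 2" using card_cube[OF cD(2)] by auto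
  have "ham_cycle ?B M" using cyclic_extD[OF IH _ MB] a M(2) cD(1) D(4) by simp
  moreover obtain w where w: "w \<in> ?A" "w \<noteq> a" "w \<noteq> ?b"
  proof -
    have "\<not> ?A \<subseteq> {a, ?b}" using cB(2) card_mono[of "{a, ?b}" ?A] by auto
    then show ?thesis using that by blast
  qed
  moreover have "flip d w \<in> ?B" using w(1) by simp
  ultimately obtain z where z: "{flip d w, z} \<in> cube_edges" "ham_path ?B M (flip d w) z"
    using ham_cycle_open[of ?B M "flip d w"] cube_matchingD(3)[OF MB] cB(1) by metis
  let ?y = "flip d z"
  have "z \<in> ?B" using ham_path_ends[OF z(2)] by blast
  then have yA: "?y \<in> ?A" using flip_in_cube_flip[of d z ?D "flip d a"] by simp
  have wy: "{w, ?y} \<in> cube_edges" using flip_cube_edge[OF z(1), of d] by simp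
  have "{a, ?b} \<noteq> {w, ?y}" using w(2,3) by (auto simp: doubleton_eq_iff)
  moreover have "?b \<in> ?A" using D(3) by simp
  ultimately have "ham_path ?A {{w, ?y}} a ?b"
    using cD a wy w(1) yA by (intro laceable[where f = "{w, ?y}"]) (auto simp: even_card_flip)
  then obtain xs where xs: "xs \<noteq> []" "hd xs = a" "last xs = ?b" "distinct xs" "set xs = ?A"
    "path_edges xs \<subseteq> cube_edges" "{w, ?y} \<in> path_edges xs"
    unfolding ham_path_def by blast
  obtain ps qs where pq: "xs = ps @ qs" "ps \<noteq> []" "qs \<noteq> []" "{w, ?y} = {last ps, hd qs}"
    using path_edges_split[OF xs(7)] .
  have B: "ham_path ?B M (flip d (last ps)) (flip d (hd qs))"
  proof -
    have z': "ham_path ?B M (flip d w) (flip d ?y)" using z(2) by simp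
    from pq(4) consider "w = last ps" "?y = hd qs" | "w = hd qs" "?y = last ps"
      by (auto simp only: doubleton_eq_iff)
    then show ?thesis using z' ham_path_rev[OF z'] by cases (simp_all only:)
  qed
  have "ham_path (cube D a) M (hd ps) (last qs)"
    by (rule path_through_halves[OF D(2) pq(2,3) _ _ _ B]) (use xs pq in \<open>auto simp: path_edges_append\<close>)
  then show ?thesis using xs(2,3) pq by simp
qed

lemma two_mult_le_power: "m \<ge> 4 \<Longrightarrow> 2 * m \<le> (2::nat) ^ (m - 1)"
proof (induction m rule: dec_induct)
  case (step n)
  have "(2::nat) ^ (Suc n - 1) = 2 * 2 ^ (n - 1)" using step(1) by (cases n) auto
  then show ?case using step by simp
qed simp

lemma path_ext_step:
  assumes D: "finite D" "card D \<ge> 3" and cyc: "cyclic_ext D"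
    and IH: "\<And>d. d \<in> D \<Longrightarrow> cyclic_ext (D - {d}) \<and> path_ext (D - {d})"
  shows "path_ext D"
  unfolding path_ext_def
proof (intro allI impI)
  fix a i M
  assume a: "finite a" and i: "i \<in> D" and M: "cube_matching D a M" "card M \<le> card D" and aM: "a \<notin> \<Union>M"
  let ?b = "flip i a"
  have finM: "finite M" using finite_cube_matching[OF M(1) D(1)] .
  show "ham_path (cube D a) M a ?b"
  proof (cases "?b \<in> \<Union>M")
    case False
    \<comment> \<open>Both ends are free: their edge joins the matching, and the cycle through it is
      cut there.\<close>
    have "card (insert {a, ?b} M) \<le> Suc (card M)" by (simp add: card_insert_if finM)
    then have "card (insert {a, ?b} M) \<le> 2 * card D - 1" using M(2) D(2) by linarith
    then have "ham_cycle (cube D a) (insert {a, ?b} M)"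
      using cyclic_extD[OF cyc a cube_matching_insert[OF M(1) cube_self i aM False]] by blast
    moreover have "{a, ?b} \<notin> M" using aM by blast
    ultimately show ?thesis by (intro ham_cycle_open_edge) auto
  next
    case True
    then obtain g where g: "g \<in> M" "?b \<in> g" by blast
    have "card M < 2 * card (D - {i})" using M(2) D i by simp
    then obtain d where d: "d \<in> D - {i}" "card (M \<inter> dir_edges d) \<le> 1"
      using sparse_direction[OF M(1) D(1), of "D - {i}"] by blast
    then have dD: "d \<in> D" and iD: "i \<in> D - {d}" using i by auto
    let ?D = "D - {d}" and ?Md = "M \<inter> dir_edges d"
    let ?A = "cube ?D a" and ?B = "cube ?D (flip d a)"
    define M0 where "M0 = {e \<in> M. e \<subseteq> ?A}"
    define M1 where "M1 = {e \<in> M. e \<subseteq> ?B}"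
    note split = matching_split[OF M(1) dD D(1) M0_def M1_def]
    have cD: "card ?D = card D - 1" "finite ?D" using D dD by simp_all
    note IHc = IH[OF dD, THEN conjunct1] and IHp = IH[OF dD, THEN conjunct2]
    have fin01: "finite M0" "finite M1" using finM by (auto simp: M0_def M1_def)
    \<comment> \<open>Without a crossing edge, a half can exceed the bound \<open>card D - 1\<close>
      of the induction hypothesis only by containing all \<open>card D\<close> edges.\<close>
    consider "card ?Md = 1" | "card ?Md = 0" "card M0 = card D" | "card ?Md = 0" "card M1 = card D"
      | "card ?Md = 0" "card M0 < card D" "card M1 < card D"
      using d(2) M(2) split(2) by linarith
    then show ?thesis
    proof cases
      case 1
      then show ?thesis using path_ext_halves_crossing[OF D(1) dD iD a IHp M(1) aM M(2)] by blast
    next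
      case 2
      then have "card M1 = 0" "card M \<ge> 2" using split(2) M(2) D(2) by linarith+
      then have "?Md = {}" "M1 = {}" using fin01 2(1) finM by simp_all
      then have "M = M0" by (subst split(1)) simp
      then have "e \<in> M0" if "e \<in> M" for e using that by metis
      then have "\<And>e. e \<in> M \<Longrightarrow> e \<subseteq> ?A" unfolding M0_def by blast
      then show ?thesis using path_ext_facet[OF D(1) dD iD a IHp M(1) aM M(2) \<open>card M \<ge> 2\<close>] by blast
    next
      case 3
      then have "card M0 = 0" using split(2) M(2) by linarith
      then have "?Md = {}" "M0 = {}" using fin01 3(1) finM by simp_all
      then have "M = M1" by (subst split(1)) simp
      then have "e \<in> M1" if "e \<in> M" for e using that by metis
      then have "\<And>e. e \<in> M \<Longrightarrow> e \<subseteq> ?B" unfolding M1_def by blast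
      then show ?thesis using path_ext_opposite_facet[OF D(1) dD iD D(2) a IHc M(1,2)] by blast
    next
      case 4
      then have "?Md = {}" using finM by simp
      then have MM: "M = M0 \<union> M1" using split(1) by blast
      have c: "card M0 \<le> card ?D" "card M1 \<le> card ?D" using 4 cD by linarith+
      have AB: "?A \<inter> ?B = {}" using cube_disjoint[OF dD] .
      have aM0: "a \<notin> \<Union>M0" using aM by (auto simp: M0_def)
      from path_extD[OF IHp a iD split(5) c(1) aM0]
      obtain xs where xs: "xs \<noteq> []" "hd xs = a" "last xs = ?b" "distinct xs" "set xs = ?A"
        "path_edges xs \<subseteq> cube_edges" "M0 \<subseteq> path_edges xs"
        unfolding ham_path_def by blast
      have insert: ?thesis if pq: "xs = ps @ qs" "ps \<noteq> []" "qs \<noteq> []"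
        and nM: "{last ps, hd qs} \<notin> M0"
        and B: "ham_path ?B M1 (flip d (last ps)) (flip d (hd qs))" for ps qs
      proof -
        have "M0 \<subseteq> path_edges ps \<union> path_edges qs"
          using xs(7) nM pq by (auto simp: path_edges_append)
        then have "ham_path (cube D a) M (hd ps) (last qs)"
          using MM xs(4-6) pq
          by (intro path_through_halves[OF dD pq(2,3) _ _ _ B]) (auto simp: path_edges_append)
        then show ?thesis using xs(2,3) pq by simp
      qed
      have edge: "{last ps, hd qs} \<in> cube_edges \<and> last ps \<in> ?A \<and> hd qs \<in> ?A"
        if pq: "xs = ps @ qs" "ps \<noteq> []" "qs \<noteq> []" for ps qs
      proof -
        have "{last ps, hd qs} \<in> path_edges xs" using pq by (simp add: path_edges_append)
        moreover have "last ps \<in> set xs" "hd qs \<in> set xs" using pq by auto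
        ultimately show ?thesis using xs(5,6) by blast
      qed
      show ?thesis
      proof (cases "\<exists>x\<in>?A. x \<noteq> ?b \<and> flip d x \<notin> \<Union>M1")
        case True
        then obtain x where x: "x \<in> ?A" "x \<noteq> ?b" "flip d x \<notin> \<Union>M1" by blast
        have path: "ham_path ?B M1 (flip d x) (flip d y)" if y: "y \<in> ?A" "{x, y} \<in> cube_edges" for y
          using path_ext_edge[OF IHp cD(2) _ split(6) c(2) flip_mem_other[OF x(1)] flip_mem_other[OF y(1)]
              flip_cube_edge[OF y(2)] x(3)] a by simp
        obtain ps qs where pq: "xs = ps @ x # qs" using split_list[of x xs] x(1) xs(5) by blast
        have qs: "qs \<noteq> []"
        proof
          assume "qs = []"
          then have "last xs = x" by (simp add: pq)
          then show False using xs(3) x(2) by metis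
        qed
        \<comment> \<open>Since \<open>x\<close> is not the last vertex, it has a successor. If the
          edge to it is in \<open>M0\<close>, then \<open>x\<close> is not the uncovered vertex
          \<open>a\<close>, and the edge to its predecessor, which is not in \<open>M0\<close>, is
          cut instead.\<close>
        show ?thesis
        proof (cases "{x, hd qs} \<in> M0")
          case False
          have *: "xs = (ps @ [x]) @ qs" using pq by simp
          have "ham_path ?B M1 (flip d x) (flip d (hd qs))"
            using edge[OF * _ qs] path by simp
          then show ?thesis using insert[OF * _ qs] False by simp
        next
          case True
          then have "x \<noteq> a" using aM0 by blast
          then have ps: "ps \<noteq> []" using pq xs(2) by auto
          have ed: "{last ps, x} \<in> cube_edges" "last ps \<in> ?A" using edge[OF pq ps] by auto
          then have "ham_path ?B M1 (flip d x) (flip d (last ps))"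
            using path by (simp add: insert_commute)
          moreover have "{last ps, x} \<notin> M0"
          proof
            assume "{last ps, x} \<in> M0"
            then have "{last ps, x} = {x, hd qs}" using cube_matching_unique[OF split(5) _ True, of _ x] by simp
            then have "last ps = hd qs" by (metis doubleton_eq_iff)
            moreover have "last ps \<in> set ps" "hd qs \<in> set qs" using ps qs by simp_all
            moreover have "set ps \<inter> set qs = {}" using xs(4) unfolding pq by auto
            ultimately show False by auto
          qed
          ultimately show ?thesis using insert[OF pq ps] ham_path_rev[of ?B M1 "flip d x"] by simp
        qed
      next
        case False
        have "flip d ` (?A - {?b}) \<subseteq> \<Union>M1" using False by blast
        moreover have UM1: "\<Union>M1 \<subseteq> ?B" by (auto simp: M1_def)
        ultimately have "card (flip d ` (?A - {?b})) \<le> card (\<Union>M1)"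
          using finite_cube[OF cD(2)] by (meson card_mono finite_subset)
        moreover have "card (flip d ` (?A - {?b})) = card (?A - {?b})"
          by (rule card_image) (simp add: inj_on_def)
        moreover have "?b \<in> ?A" using iD by simp
        then have "card (?A - {?b}) = 2 ^ (card D - 1) - 1"
          using card_cube[OF cD(2), of a] cD(1) by simp
        ultimately have le: "2 ^ (card D - 1) - 1 \<le> 2 * card M1"
          using card_Union_matching[OF split(6) cD(2)] by simp
        \<comment> \<open>With n = \<open>card D\<close>, all but possibly one vertex of the upper
          half are covered by at most n - 1 edges. So 2 ^ (n - 1) - 1 <= 2(n - 1), which fails from
          n = 4 on.\<close>
        have c3: "card D = 3"
        proof (rule ccontr)
          assume "card D \<noteq> 3"
          then have "2 * card D \<le> 2 ^ (card D - 1)" using D(2) by (intro two_mult_le_power) simp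
          then show False using le c(2) cD(1) D(2) by linarith
        qed
        then have "card M1 \<ge> 2" using le by simp
        then have "card M0 \<le> 1" using split(2) 4(1) M(2) c3 by linarith
        have "g \<in> M0"
        proof (rule ccontr)
          assume "g \<notin> M0"
          then have "g \<in> M1" using g(1) MM by (metis UnE)
          then have "g \<subseteq> ?B" unfolding M1_def by blast
          then show False using g(2) \<open>?b \<in> ?A\<close> AB by blast
        qed
        moreover have "\<forall>e\<in>M0. \<forall>f\<in>M0. e = f"
          using \<open>card M0 \<le> 1\<close> card_le_Suc0_iff_eq[OF fin01(1)] by simp
        ultimately have M0g: "e = g" if "e \<in> M0" for e using that by blast
        have "length xs = 4"
          using distinct_card[OF xs(4)] xs(5) card_cube[OF cD(2), of a] cD(1) c3 by simp
        then obtain z u v where "xs = [a, z, u, v]"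
          using xs(2) by (auto simp: numeral_eq_Suc length_Suc_conv)
        then have xs4: "xs = [a, z, u, ?b]" using xs(3) by simp
        have square: "ham_path ?B M1 (flip d s) (flip d t)"
          if st: "s \<in> ?A" "t \<in> ?A" "{s, t} \<in> cube_edges" "{flip d s, flip d t} \<notin> M1" for s t
        proof -
          obtain k where k: "flip d t = flip k (flip d s)"
            using flip_cube_edge[OF st(3), of d] cube_edge_iff by blast
          have sB: "flip d s \<in> ?B" "flip d t \<in> ?B" using st by simp_all
          have "flip k (flip d s) \<in> ?B" using sB(2) by (simp only: k)
          then have kD: "k \<in> ?D" using flip_in_cubeD sB(1) by blast
          have eqB: "cube ?D (flip d s) = ?B" by (rule cube_eq[OF sB(1)])
          have "ham_path (cube ?D (flip d s)) M1 (flip d s) (flip k (flip d s))"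
          proof (rule square_ham_path)
            show "M1 \<subseteq> cube_edges" using cube_matchingD(1)[OF split(6)] by blast
            show "e \<subseteq> cube ?D (flip d s)" if "e \<in> M1" for e
              using cube_matchingD(2)[OF split(6) that] by (simp only: eqB)
            show "{flip d s, flip k (flip d s)} \<notin> M1" using st(4) unfolding k .
          qed (use cD(1) c3 kD in simp_all)
          then show ?thesis by (simp only: k eqB)
        qed
        have 1: "xs = [a] @ [z, u, ?b]" and 2: "xs = [a, z] @ [u, ?b]" using xs4 by simp_all
        have e1: "{a, z} \<in> cube_edges" "a \<in> ?A" "z \<in> ?A" using edge[OF 1] by simp_all
        have e2: "{z, u} \<in> cube_edges" "u \<in> ?A" using edge[OF 2] by simp_all
        have dist: "a \<noteq> z" "a \<noteq> u" "?b \<noteq> a" "?b \<noteq> z" "?b \<noteq> u" using xs(4) xs4 by auto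
        have n1: "{a, z} \<notin> M0" using aM0 by blast
        \<comment> \<open>The only edge that \<open>M0\<close> can contain is \<open>g\<close>,
          which meets \<open>?b\<close>. So the first two edges of the path may both be cut.\<close>
        have n2: "{z, u} \<notin> M0" using M0g[of "{z, u}"] g(2) dist by auto
        \<comment> \<open>The mirror images of these two edges share the vertex
          \<open>flip d z\<close>, so at most one is in \<open>M1\<close>. At the other one, the
          path around the square contains all of \<open>M1\<close>, although its ends may both be
          covered.\<close>
        show ?thesis
        proof (cases "{flip d a, flip d z} \<in> M1")
          case False
          then show ?thesis using insert[OF 1] n1 square[OF e1(2,3,1)] by simp
        next
          case True
          have "{flip d z, flip d u} \<notin> M1"
          proof
            assume "{flip d z, flip d u} \<in> M1"
            then have "{flip d z, flip d u} = {flip d a, flip d z}"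
              using cube_matching_unique[OF split(6) _ True, of _ "flip d z"] by simp
            then show False using dist by (auto simp: doubleton_eq_iff)
          qed
          then show ?thesis using insert[OF 2] n2 square[OF e1(3) e2(2,1)] by simp
        qed
      qed
    qed
  qed
qed

text \<open>The Hamiltonian cycle of a square consists of all four of its edges.\<close>

lemma square_ext:
  assumes "card D = 2"
  shows "cyclic_ext D \<and> path_ext D"
proof
  show "path_ext D" unfolding path_ext_def
  proof (intro allI impI)
    fix a i M
    assume "i \<in> D" "cube_matching D a M" "a \<notin> \<Union>M"
    then show "ham_path (cube D a) M a (flip i a)"
      using assms cube_matchingD(1,2)[of D a M] by (intro square_ham_path) auto
  qed
  show "cyclic_ext D" unfolding cyclic_ext_def
  proof (intro allI impI)
    fix a M
    assume M: "cube_matching D a M"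
    obtain i where i: "i \<in> D" using assms by fastforce
    have "ham_path (cube D a) (M - {{a, flip i a}}) a (flip i a)"
      using i assms cube_matchingD(1,2)[OF M] by (intro square_ham_path) auto
    from ham_path_close[OF this flip_edge(2)] show "ham_cycle (cube D a) M"
      by (rule ham_cycle_mono) (auto simp: insert_commute)
  qed
qed

theorem cyclic_path_ext:
  assumes "finite D" "card D \<ge> 2"
  shows "cyclic_ext D \<and> path_ext D"
  using assms
proof (induction "card D" arbitrary: D rule: less_induct)
  case less
  show ?case
  proof (cases "card D = 2")
    case True
    then show ?thesis by (rule square_ext)
  next
    case False
    then have c: "card D \<ge> 3" using less.prems by linarith
    have IH: "cyclic_ext (D - {d}) \<and> path_ext (D - {d})" if "d \<in> D" for d
      using that c less.prems by (intro less.hyps) (auto simp: card_Diff_singleton)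
    have "cyclic_ext D" using cyclic_ext_step[OF less.prems(1) c IH] .
    then show ?thesis using path_ext_step[OF less.prems(1) c _ IH] by blast
  qed
qed

section \<open>Transfer to bit strings\<close>

lemma path_edges_map: "path_edges (map f xs) = (`) f ` path_edges xs"
  by (induction xs rule: path_edges.induct) auto

lemma closed_edges_map: "xs \<noteq> [] \<Longrightarrow> closed_edges (map f xs) = (`) f ` closed_edges xs"
  by (simp add: closed_edges_def path_edges_map last_map hd_map)

definition ones :: "bool list \<Rightarrow> nat set" where
  "ones v = {i. i < length v \<and> v ! i}"

definition bits :: "nat \<Rightarrow> nat set \<Rightarrow> bool list" where
  "bits n X = map (\<lambda>i. i \<in> X) [0..<n]"

lemma bits_ones: "length v = n \<Longrightarrow> bits n (ones v) = v"
  by (auto simp: bits_def ones_def intro: nth_equalityI)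

lemma ones_bits: "X \<subseteq> {..<n} \<Longrightarrow> ones (bits n X) = X"
  by (auto simp: bits_def ones_def)

lemma length_bits [simp]: "length (bits n X) = n"
  by (simp add: bits_def)

lemma ones_edge:
  assumes "e \<in> hypercube_edges n"
  shows "ones ` e \<in> cube_edges"
proof -
  obtain u v where uv: "e = {u, v}" "length u = n" "length v = n"
    and ex: "\<exists>!i. i < n \<and> u ! i \<noteq> v ! i"
    using assms unfolding hypercube_edges_def hypercube_verts_def mem_Collect_eq by (elim exE conjE)
  from ex1_implies_ex[OF ex] obtain i where i: "i < n" "u ! i \<noteq> v ! i" by blast
  have uniq: "j = i" if "j < n" "u ! j \<noteq> v ! j" for j
    using ex i that by (metis (no_types, lifting))
  have "j \<in> ones v \<longleftrightarrow> j \<in> flip i (ones u)" for j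
  proof (cases "j = i")
    case True
    then show ?thesis using i uv(2,3) by (simp add: mem_flip ones_def)
  next
    case False
    then have "j < n \<Longrightarrow> u ! j = v ! j" using uniq by blast
    then show ?thesis using False uv(2,3) by (auto simp: mem_flip ones_def)
  qed
  then have "ones v = flip i (ones u)" by blast
  then show ?thesis using uv(1) by simp
qed

lemma bits_edge:
  assumes "e \<in> cube_edges" "e \<subseteq> Pow {..<n}"
  shows "bits n ` e \<in> hypercube_edges n"
proof -
  obtain X i where e: "e = {X, flip i X}" using cube_edgeE[OF assms(1)] .
  have i: "i < n" using assms(2) e by (auto simp: flip_def split: if_splits)
  have "\<exists>!j. j < n \<and> bits n X ! j \<noteq> bits n (flip i X) ! j"
    using i by (intro ex1I[of _ i]) (auto simp: bits_def mem_flip)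
  then show ?thesis unfolding hypercube_edges_def hypercube_verts_def e
    by (intro CollectI exI[of _ "bits n X"] exI[of _ "bits n (flip i X)"]) simp
qed

theorem theorem5p1:
  fixes n :: nat and M :: "bool list set set"
  assumes "n \<ge> 2"
    and "matching (hypercube_edges n) M"
    and "card M \<le> 2 * n - 1"
  shows "\<exists>c. hamiltonian_cycle (hypercube_verts n) (hypercube_edges n) c \<and> M \<subseteq> cycle_edges c"
proof -
  let ?V = "hypercube_verts n" and ?D = "{..<n}"
  let ?N = "(`) ones ` M"
  have len: "length v = n" if "v \<in> e" "e \<in> hypercube_edges n" for v e
    using that by (auto simp: hypercube_edges_def hypercube_verts_def)
  have ME: "M \<subseteq> hypercube_edges n" and disj: "pairwise disjnt M"
    using assms(2) by (auto simp: matching_def)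
  \<comment> \<open>The whole hypercube is the subcube through the empty set, that is, through the
    all-zero string.\<close>
  have V: "cube ?D {} = Pow ?D" by (auto simp: mem_cube)
  have "finite ?V"
    using finite_lists_length_eq[of "UNIV :: bool set" n] by (simp add: hypercube_verts_def)
  moreover have "M \<subseteq> Pow ?V" using ME len by (auto simp: hypercube_verts_def)
  ultimately have finM: "finite M" by (meson finite_Pow_iff finite_subset)
  have N: "cube_matching ?D {} ?N"
    unfolding cube_matching_def V
  proof (intro conjI ballI impI subsetI)
    show "e \<in> cube_edges" if "e \<in> ?N" for e using that ones_edge ME by blast
    show "X \<in> Pow ?D" if "e \<in> ?N" "X \<in> e" for e X
      using that ME len by (auto simp: ones_def)
    fix e f assume "e \<in> ?N" "f \<in> ?N" "e \<inter> f \<noteq> {}"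
    then obtain e' f' u v where ef: "e' \<in> M" "f' \<in> M" "e = ones ` e'" "f = ones ` f'"
      "u \<in> e'" "v \<in> f'" "ones u = ones v" by auto
    then have "length u = n" "length v = n" using len ME by blast+
    then have "u = v" using ef(7) bits_ones by metis
    then have "e' = f'" using ef(1,2,5,6) disj by (auto simp: pairwise_def disjnt_def)
    then show "e = f" using ef by simp
  qed
  moreover have "card ?N \<le> 2 * card ?D - 1" using card_image_le[OF finM, of "(`) ones"] assms(3) by simp
  ultimately have "ham_cycle (Pow ?D) ?N"
    using cyclic_path_ext[of ?D] cyclic_extD[of ?D "{}" ?N] assms(1) V by simp
  then obtain xs where xs: "xs \<noteq> []" "distinct xs" "set xs = Pow ?D"
    "closed_edges xs \<subseteq> cube_edges" "?N \<subseteq> closed_edges xs"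
    unfolding ham_cycle_def by blast
  let ?c = "map (bits n) xs"
  have ce: "cycle_edges ?c = (`) (bits n) ` closed_edges xs"
    using xs(1) by (simp add: closed_edges_eq_cycle_edges[symmetric] closed_edges_map)
  have sub: "e \<subseteq> Pow ?D" if "e \<in> closed_edges xs" for e
    using that path_edges_subset[of e xs] xs(1,3) hd_in_set[of xs] last_in_set[of xs]
    by (auto simp: closed_edges_def)
  have "length ?c = 2 ^ n" using distinct_card[OF xs(2)] xs(3) by (simp add: card_Pow)
  moreover have "(2::nat) ^ 2 \<le> 2 ^ n" using assms(1) by (intro power_increasing) auto
  ultimately have "3 \<le> length ?c" by simp
  moreover have "distinct ?c"
    using xs(2,3) ones_bits by (auto simp: distinct_map intro!: inj_on_inverseI[of _ ones])
  moreover have "set ?c = ?V"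
  proof
    show "?V \<subseteq> set ?c"
    proof
      fix v assume "v \<in> ?V"
      then have "v = bits n (ones v)" "ones v \<in> set xs"
        using xs(3) by (simp_all add: hypercube_verts_def bits_ones) (auto simp: ones_def)
      then show "v \<in> set ?c" by (metis image_eqI list.set_map)
    qed
  qed (auto simp: hypercube_verts_def)
  moreover have "cycle_edges ?c \<subseteq> hypercube_edges n"
  proof
    fix f assume "f \<in> cycle_edges ?c"
    then obtain e where e: "e \<in> closed_edges xs" "f = bits n ` e" unfolding ce by (elim imageE)
    have "e \<in> cube_edges" using e(1) xs(4) by (rule rev_subsetD)
    then show "f \<in> hypercube_edges n" unfolding e(2) using sub[OF e(1)] by (rule bits_edge)
  qed
  moreover have "M \<subseteq> cycle_edges ?c"
  proof
    fix e assume e: "e \<in> M"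
    have "bits n ` ones ` e = e"
    proof -
      have "e \<in> hypercube_edges n" using e ME by (rule rev_subsetD)
      then have "bits n (ones v) = v" if "v \<in> e" for v
        using len[OF that] bits_ones[of v n] by blast
      then show ?thesis by (simp add: image_image)
    qed
    moreover have "ones ` e \<in> closed_edges xs" using imageI[OF e] xs(5) by (rule rev_subsetD)
    ultimately show "e \<in> cycle_edges ?c" unfolding ce by (metis image_eqI)
  qed
  ultimately show ?thesis unfolding hamiltonian_cycle_def by blast
qed

end
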